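(* Let $\Lambda$ be a multiplicative Nambu-Poisson tensor of order $n$ on a Lie group $G$ with Lie algebra $\mathfrak g$, and let $\delta_\Lambda:\mathfrak g\to\bigwedge^n\mathfrak g$ be the corresponding Lie algebra 1-cocycle. Then the map $\delta_\Lambda^*:\bigwedge^n\mathfrak g^*\to\mathfrak g^*$ dual to $\delta_\Lambda$ defines a linear Nambu-Poisson (in particular, Filippov) bracket on $\mathfrak g^*$; that is, the linear $n$-vector field $X\mapsto\delta_\Lambda(X)$ on the vector space $\mathfrak g$ is a Nambu-Poisson tensor (and in particular the bracket $\delta_\Lambda^*$ on $\mathfrak g^*$ satisfies the Filippov identity).
   Context: Lie groups are real and finite-dimensional, tensors are smooth; $L_g,R_g$ are left and right translations. The Filippov identity for an $n$-linear skew-symmetric bracket is $$[f_1,\dots,f_{n-1},[g_1,\dots,g_n]]=\sum_{i=1}^n[g_1,\dots,[f_1,\dots,f_{n-1},g_i],\dots,g_n].$$ An $n$-vector field $\Lambda$ on a manifold is a Nambu-Poisson tensor of order $n$ if the bracket $\{f_1,\dots,f_n\}=i_{df_n}\cdots i_{df_1}\Lambda$ satisfies the Filippov identity for all smooth functions. An $n$-vector field $\Lambda$ on $G$ is multiplicative if $\Lambda(gg')=(L_g)_*\Lambda(g')+(R_{g'})_*\Lambda(g)$ for all $g,g'\in G$. Equivalently, its right trivialization $\tilde\Lambda:G\to\bigwedge^n\mathfrak g$, $\tilde\Lambda(g)=(R_{g^{-1}})_*\Lambda(g)$, satisfies $\tilde\Lambda(gg')=\tilde\Lambda(g)+\mathrm{Ad}_g\tilde\Lambda(g')$.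 The Lie algebra 1-cocycle $\delta_\Lambda:\mathfrak g\to\bigwedge^n\mathfrak g$ is defined by the intrinsic derivative $\delta_\Lambda(X)=(\mathcal L_{\tilde X}\tilde\Lambda)(e)$, the derivative of $\tilde\Lambda$ at $e$ in direction $X$, where $\tilde X$ is any vector field on $G$ with $\tilde X(e)=X$. An $n$-linear skew-symmetric bracket on $\mathfrak g^*$ is identified with a linear $n$-vector field on $\mathfrak g=(\mathfrak g^* )^*$, elements of $\mathfrak g^*$ being linear functions on $\mathfrak g$. *)

theory Defs
  imports "HOL-Analysis.Analysis" "HOL-Library.Function_Algebras"
begin

section \<open>Smooth maps and smooth manifolds\<close>

text \<open>Meant for open \<open>S\<close> in a finite-dimensional space, where requiring all iterated
  directional derivatives to exist and be continuous is the usual \<open>C\<^sup>k\<close> condition.\<close>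

primrec Ck_on :: "nat \<Rightarrow> 'a::real_normed_vector set \<Rightarrow> ('a \<Rightarrow> 'b::real_normed_vector) \<Rightarrow> bool" where
  "Ck_on 0 S f \<longleftrightarrow> continuous_on S f"
| "Ck_on (Suc k) S f \<longleftrightarrow> (\<forall>x\<in>S. f differentiable (at x)) \<and>
     (\<forall>v. Ck_on k S (\<lambda>x. frechet_derivative f (at x) v))"

definition smooth_on :: "'a::real_normed_vector set \<Rightarrow> ('a \<Rightarrow> 'b::real_normed_vector) \<Rightarrow> bool" where
  "smooth_on S f \<longleftrightarrow> (\<forall>k. Ck_on k S f)"

type_synonym ('p, 'e) chart = "'p set \<times> ('p \<Rightarrow> 'e)"

text \<open>The model space is any finite-dimensional real inner product space; unlike
  \<open>euclidean_space\<close> this includes dimension 0.\<close>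

definition smooth_manifold ::
  "('p::{t2_space, second_countable_topology}, 'e::real_inner) chart set \<Rightarrow> bool" where
  "smooth_manifold A \<longleftrightarrow>
     (\<exists>B::'e set. finite B \<and> span B = UNIV) \<and>
     (\<Union>(U, \<phi>)\<in>A. U) = UNIV \<and>
     (\<forall>(U, \<phi>)\<in>A. open U \<and> open (\<phi> ` U) \<and> homeomorphism U (\<phi> ` U) \<phi> (inv_into U \<phi>)) \<and>
     (\<forall>(U, \<phi>)\<in>A. \<forall>(V, \<psi>)\<in>A. smooth_on (\<phi> ` (U \<inter> V)) (\<psi> \<circ> inv_into U \<phi>))"

definition smooth_map ::
  "('p::topological_space, 'e::real_normed_vector) chart set \<Rightarrow>
   ('q::topological_space, 'f::real_normed_vector) chart set \<Rightarrow> ('p \<Rightarrow> 'q) \<Rightarrow> bool" where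
  "smooth_map A B f \<longleftrightarrow> continuous_on UNIV f \<and>
     (\<forall>(U, \<phi>)\<in>A. \<forall>(V, \<psi>)\<in>B. smooth_on (\<phi> ` (U \<inter> f -` V)) (\<psi> \<circ> f \<circ> inv_into U \<phi>))"

definition flat_atlas :: "('e, 'e) chart set" where
  "flat_atlas = {(UNIV, id)}"

definition prod_atlas ::
  "('p, 'e) chart set \<Rightarrow> ('q, 'f) chart set \<Rightarrow> ('p \<times> 'q, 'e \<times> 'f) chart set" where
  "prod_atlas A B = {(U \<times> V, map_prod \<phi> \<psi>) | U \<phi> V \<psi>. (U, \<phi>) \<in> A \<and> (V, \<psi>) \<in> B}"

definition smooth_functions ::
  "('p::topological_space, 'e::real_normed_vector) chart set \<Rightarrow> ('p \<Rightarrow> real) set" where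
  "smooth_functions A = {f. smooth_map A flat_atlas f}"


section \<open>Tangent spaces and multivectors\<close>

text \<open>The tangent space at \<open>p\<close> is the model space \<open>'e\<close>, a tangent vector being represented by
  its coordinates in one fixed chart around \<open>p\<close>; tangent maps are expressed in these charts.
  On a vector space with the atlas \<^const>\<open>flat_atlas\<close> this is the canonical identification of
  every tangent space with the vector space itself.  The cotangent space is \<open>'e \<Rightarrow>\<^sub>L real\<close>.\<close>

definition chart_at :: "('p, 'e) chart set \<Rightarrow> 'p \<Rightarrow> ('p, 'e) chart" where
  "chart_at A p = (SOME c. c \<in> A \<and> p \<in> fst c)"

definition tangent_map ::
  "('p, 'e::real_normed_vector) chart set \<Rightarrow> ('q, 'f::real_normed_vector) chart set \<Rightarrow>
   ('p \<Rightarrow> 'q) \<Rightarrow> 'p \<Rightarrow> 'e \<Rightarrow>\<^sub>L 'f" where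
  "tangent_map A B f p =
     (let (U, \<phi>) = chart_at A p; (V, \<psi>) = chart_at B (f p)
      in Blinfun (frechet_derivative (\<psi> \<circ> f \<circ> inv_into U \<phi>) (at (\<phi> p))))"

abbreviation differential ::
  "('p, 'e::real_normed_vector) chart set \<Rightarrow> ('p \<Rightarrow> real) \<Rightarrow> 'p \<Rightarrow> 'e \<Rightarrow>\<^sub>L real" where
  "differential A f p \<equiv> tangent_map A flat_atlas f p"

text \<open>Only lists of length \<open>n\<close> are relevant.\<close>

definition skew_multilinear :: "nat \<Rightarrow> ('v::real_vector list \<Rightarrow> 'w::real_vector) \<Rightarrow> bool" where
  "skew_multilinear n T \<longleftrightarrow>
     (\<forall>vs i. length vs = n \<and> i < n \<longrightarrow> linear (\<lambda>v. T (vs[i := v]))) \<and>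
     (\<forall>vs i j. length vs = n \<and> i < n \<and> j < n \<and> i \<noteq> j \<longrightarrow>
        T (vs[i := vs ! j, j := vs ! i]) = - T vs)"

text \<open>The \<open>n\<close>-th exterior power of a finite-dimensional space \<open>'e\<close>, realised as the
  skew-symmetric contravariant \<open>n\<close>-tensors, i.e. skew \<open>n\<close>-linear forms on the dual of \<open>'e\<close>.
  Extension by \<open>0\<close> to lists of other lengths makes equality and addition the pointwise ones.\<close>

type_synonym 'e tensor = "('e \<Rightarrow>\<^sub>L real) list \<Rightarrow> real"

definition multivectors :: "nat \<Rightarrow> 'e::real_normed_vector tensor set" where
  "multivectors n = {T. skew_multilinear n T \<and> (\<forall>\<alpha>s. length \<alpha>s \<noteq> n \<longrightarrow> T \<alpha>s = 0)}"

definition pushforward ::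
  "'e::real_normed_vector \<Rightarrow>\<^sub>L 'f::real_normed_vector \<Rightarrow> 'e tensor \<Rightarrow> 'f tensor" where
  "pushforward L T = (\<lambda>\<alpha>s. T (map (\<lambda>\<alpha>. \<alpha> o\<^sub>L L) \<alpha>s))"

text \<open>Smoothness means that the components in every chart are smooth.\<close>

definition multivector_field ::
  "('p::topological_space, 'e::real_normed_vector) chart set \<Rightarrow> nat \<Rightarrow> ('p \<Rightarrow> 'e tensor) \<Rightarrow> bool" where
  "multivector_field A n \<Lambda> \<longleftrightarrow>
     (\<forall>p. \<Lambda> p \<in> multivectors n) \<and>
     (\<forall>(U, \<phi>)\<in>A. \<forall>\<alpha>s. length \<alpha>s = n \<longrightarrow>
        smooth_on (\<phi> ` U) ((\<lambda>p. pushforward (tangent_map A flat_atlas \<phi> p) (\<Lambda> p) \<alpha>s) \<circ> inv_into U \<phi>))"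


section \<open>Filippov brackets and Nambu-Poisson tensors\<close>

definition filippov_identity ::
  "nat \<Rightarrow> 'v set \<Rightarrow> ('v::comm_monoid_add list \<Rightarrow> 'v) \<Rightarrow> bool" where
  "filippov_identity n S br \<longleftrightarrow>
     (\<forall>fs gs. length fs = n - 1 \<and> length gs = n \<and> set fs \<subseteq> S \<and> set gs \<subseteq> S \<longrightarrow>
        br (fs @ [br gs]) = (\<Sum>i<n. br (gs[i := br (fs @ [gs ! i])])))"

definition filippov_bracket :: "nat \<Rightarrow> ('v::real_vector list \<Rightarrow> 'v) \<Rightarrow> bool" where
  "filippov_bracket n br \<longleftrightarrow> skew_multilinear n br \<and> filippov_identity n UNIV br"

definition tensor_bracket ::
  "('p, 'e::real_normed_vector) chart set \<Rightarrow> ('p \<Rightarrow> 'e tensor) \<Rightarrow> ('p \<Rightarrow> real) list \<Rightarrow> 'p \<Rightarrow> real" where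
  "tensor_bracket A \<Lambda> fs = (\<lambda>p. \<Lambda> p (map (\<lambda>f. differential A f p) fs))"

definition nambu_poisson ::
  "('p::topological_space, 'e::real_normed_vector) chart set \<Rightarrow> nat \<Rightarrow> ('p \<Rightarrow> 'e tensor) \<Rightarrow> bool" where
  "nambu_poisson A n \<Lambda> \<longleftrightarrow>
     multivector_field A n \<Lambda> \<and> filippov_identity n (smooth_functions A) (tensor_bracket A \<Lambda>)"


section \<open>Multiplicative tensors on Lie groups\<close>

definition lie_group ::
  "('g::{t2_space, second_countable_topology}, 'e::real_inner) chart set \<Rightarrow>
   ('g \<Rightarrow> 'g \<Rightarrow> 'g) \<Rightarrow> 'g \<Rightarrow> ('g \<Rightarrow> 'g) \<Rightarrow> bool" where
  "lie_group A mul e iv \<longleftrightarrow>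
     smooth_manifold A \<and> group mul e iv \<and>
     smooth_map (prod_atlas A A) A (\<lambda>(g, h). mul g h) \<and> smooth_map A A iv"

definition multiplicative ::
  "('g, 'e::real_normed_vector) chart set \<Rightarrow> ('g \<Rightarrow> 'g \<Rightarrow> 'g) \<Rightarrow> ('g \<Rightarrow> 'e tensor) \<Rightarrow> bool" where
  "multiplicative A mul \<Lambda> \<longleftrightarrow>
     (\<forall>g h. \<Lambda> (mul g h) =
        pushforward (tangent_map A A (\<lambda>x. mul g x) h) (\<Lambda> h) +
        pushforward (tangent_map A A (\<lambda>x. mul x h) g) (\<Lambda> g))"

text \<open>The Lie algebra, as a vector space, is the tangent space at \<open>e\<close>, hence the type \<open>'e\<close>.\<close>

definition right_trivialization ::
  "('g, 'e::real_normed_vector) chart set \<Rightarrow> ('g \<Rightarrow> 'g \<Rightarrow> 'g) \<Rightarrow> ('g \<Rightarrow> 'g) \<Rightarrow>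
   ('g \<Rightarrow> 'e tensor) \<Rightarrow> 'g \<Rightarrow> 'e tensor" where
  "right_trivialization A mul iv \<Lambda> g =
     pushforward (tangent_map A A (\<lambda>x. mul x (iv g)) g) (\<Lambda> g)"

text \<open>The directional derivative at \<open>e\<close> of a map into the finite-dimensional space of
  multivectors, taken componentwise.\<close>

definition intrinsic_derivative ::
  "('g, 'e::real_normed_vector) chart set \<Rightarrow> ('g \<Rightarrow> 'e tensor) \<Rightarrow> 'g \<Rightarrow> 'e \<Rightarrow> 'e tensor" where
  "intrinsic_derivative A T e X = (\<lambda>\<alpha>s. differential A (\<lambda>g. T g \<alpha>s) e X)"

definition cocycle ::
  "('g, 'e::real_normed_vector) chart set \<Rightarrow> ('g \<Rightarrow> 'g \<Rightarrow> 'g) \<Rightarrow> 'g \<Rightarrow> ('g \<Rightarrow> 'g) \<Rightarrow>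
   ('g \<Rightarrow> 'e tensor) \<Rightarrow> 'e \<Rightarrow> 'e tensor" where
  "cocycle A mul e iv \<Lambda> = intrinsic_derivative A (right_trivialization A mul iv \<Lambda>) e"

definition linear_multivector_field :: "('e::real_normed_vector \<Rightarrow> 'e tensor) \<Rightarrow> bool" where
  "linear_multivector_field \<delta> \<longleftrightarrow> (\<forall>\<alpha>s. linear (\<lambda>X. \<delta> X \<alpha>s))"

text \<open>For linear \<open>\<delta>\<close>, \<open>\<delta>\<^sup>*(\<alpha>\<^sub>1, \<dots>, \<alpha>\<^sub>n)\<close> is the covector
  \<open>X \<mapsto> \<delta>(X)(\<alpha>\<^sub>1, \<dots>, \<alpha>\<^sub>n)\<close>.\<close>

definition dual_bracket ::
  "('e::real_normed_vector \<Rightarrow> 'e tensor) \<Rightarrow> ('e \<Rightarrow>\<^sub>L real) list \<Rightarrow> 'e \<Rightarrow>\<^sub>L real" where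
  "dual_bracket \<delta> \<alpha>s = Blinfun (\<lambda>X. \<delta> X \<alpha>s)"

end

theory Submission imports Defs begin

text \<open>
  A multiplicative tensor vanishes at the unit: \<open>\<Lambda>(e \<cdot> e) = \<Lambda>(e)\<close> forces \<open>\<Lambda>(e) = 2 \<Lambda>(e)\<close>
  (\<open>vanishes_at_unit\<close>).  At a zero of a tensor field the derivative is independent of any trivialization, so
  \<open>\<delta>\<close>, defined through the right trivialization, is the linear part of \<open>\<Lambda>\<close> at \<open>e\<close> in the
  coordinates of a chart (\<open>cocycle_eq_linearization\<close>).  The theorem is thereby reduced to a local statement,
  in which the group is no longer visible: the linear part of a Nambu-Poisson tensor at a zero is a
  Nambu-Poisson tensor (\<open>filippov_at_linearization\<close>).

  The local statement is proved by rescaling.  Let \<open>T\<close> be the coordinate expression of \<open>\<Lambda>\<close> around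
  \<open>x0\<close>, with \<open>T(x0) = 0\<close>.  The tensors \<open>X \<mapsto> T(x0 + t X) / t\<close> satisfy the Filippov identity for every
  \<open>t > 0\<close>, since the identity is invariant under affine changes of coordinates and both sides are quadratic in
  the tensor.  As \<open>t\<close> tends to \<open>0\<close> they
  converge together with their first derivatives to \<open>\<delta>\<close>.  Only first derivatives of the tensor occur in
  the identity, so it passes to the limit.  In the formal proof the rescaling is moved to the functions:
  the identity for \<open>T\<close> is applied at \<open>x0 + t X\<close> to \<open>y \<mapsto> t f((y - x0)/t)\<close> and divided by \<open>t\<close>.
  To see the convergence, brackets are expanded into components with respect to a frame
  (\<open>tensor_bracket_flat_expand\<close>, \<open>iterated_bracket_tendsto\<close>).

  The identity for \<open>T\<close> is required for functions of the coordinates, whereas the hypothesis concerns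
  functions on the whole manifold.  Smooth cutoff functions bridge the gap
  (\<open>smooth_cutoff_exists\<close>, \<open>chart_rep_filippov_at\<close>).

  Restricting the identity for \<open>\<delta>\<close> to linear functions gives the statement about the dual
  bracket (\<open>filippov_bracket_dual\<close>).
\<close>

section \<open>Smooth maps on open sets\<close>

lemma frechet_derivative_cong_open:
  assumes "open S" "x \<in> S" "\<And>y. y \<in> S \<Longrightarrow> f y = g y"
  shows "frechet_derivative f (at x) = frechet_derivative g (at x)"
proof -
  have "(f has_derivative d) (at x) \<longleftrightarrow> (g has_derivative d) (at x)" for d
    using assms has_derivative_transform_within_open[of _ d x UNIV S]
    by metis
  then show ?thesis by (simp add: frechet_derivative_def)
qed

lemma differentiable_cong_open:
  assumes "open S" "x \<in> S" "\<And>y. y \<in> S \<Longrightarrow> f y = g y"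
  shows "f differentiable (at x) \<longleftrightarrow> g differentiable (at x)"
  unfolding differentiable_def
  using assms has_derivative_transform_within_open[of _ _ x UNIV S] by metis

lemma Ck_on_cong:
  assumes "open S" "\<And>x. x \<in> S \<Longrightarrow> f x = g x"
  shows "Ck_on k S f \<longleftrightarrow> Ck_on k S g"
  using assms(2)
proof (induction k arbitrary: f g)
  case 0
  then show ?case by (auto intro: continuous_on_eq)
next
  case (Suc k)
  have "Ck_on k S (\<lambda>x. frechet_derivative f (at x) v) \<longleftrightarrow> Ck_on k S (\<lambda>x. frechet_derivative g (at x) v)" for v
    by (rule Suc.IH) (use frechet_derivative_cong_open[OF assms(1)] Suc.prems in metis)
  then show ?case using differentiable_cong_open[OF assms(1) _ Suc.prems] by auto
qed

lemma Ck_on_Un: "open S \<Longrightarrow> open T \<Longrightarrow> Ck_on k S f \<Longrightarrow> Ck_on k T f \<Longrightarrow> Ck_on k (S \<union> T) f"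
  by (induction k arbitrary: f) (auto intro: continuous_on_open_Un)

text \<open>The way a derivative computed by hand enters the recursive definition of \<open>Ck_on\<close>:
  on an open set it agrees with \<^const>\<open>frechet_derivative\<close>, so the two may be exchanged.\<close>
lemma Ck_on_SucI:
  assumes "open S" "\<And>x. x \<in> S \<Longrightarrow> (f has_derivative f' x) (at x)" "\<And>v. Ck_on k S (\<lambda>x. f' x v)"
  shows "Ck_on (Suc k) S f"
proof -
  have "Ck_on k S (\<lambda>x. frechet_derivative f (at x) v)" for v
    using Ck_on_cong[OF assms(1), of "\<lambda>x. frechet_derivative f (at x) v" "\<lambda>x. f' x v"] assms(2,3)
      frechet_derivative_at by metis
  then show ?thesis using assms(2) by (auto simp: differentiable_def)
qed

lemma Ck_on_SucD: "Ck_on (Suc k) S f \<Longrightarrow> Ck_on k S f"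
proof (induction k arbitrary: f)
  case 0
  then show ?case
    by (auto simp: continuous_on_eq_continuous_within intro!: differentiable_imp_continuous_within
        intro: differentiable_at_withinI)
next
  case (Suc k)
  then show ?case by (simp add: Ck_on.simps(2)[of "Suc k"])
qed

lemma Ck_on_const: "open S \<Longrightarrow> Ck_on k S (\<lambda>x. c)"
proof (induction k arbitrary: c)
  case (Suc k)
  then show ?case by (intro Ck_on_SucI[where f' = "\<lambda>_ _. 0"]) auto
qed auto

lemma Ck_on_bounded_linear: "open S \<Longrightarrow> bounded_linear f \<Longrightarrow> Ck_on k S f"
  by (cases k) (auto intro: linear_continuous_on intro!: Ck_on_SucI[where f' = "\<lambda>_. f"]
     bounded_linear_imp_has_derivative Ck_on_const simp del: Ck_on.simps(2))

lemma Ck_on_add: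
  "open S \<Longrightarrow> Ck_on k S f \<Longrightarrow> Ck_on k S g \<Longrightarrow> Ck_on k S (\<lambda>x. f x + g x)"
proof (induction k arbitrary: f g)
  case (Suc k)
  then show ?case
    by (intro Ck_on_SucI[where f' = "\<lambda>x v. frechet_derivative f (at x) v + frechet_derivative g (at x) v"])
       (auto intro!: has_derivative_add simp: frechet_derivative_works[THEN iffD1])
qed (auto intro: continuous_intros)

lemma Ck_on_sum:
  "finite I \<Longrightarrow> open S \<Longrightarrow> (\<And>i. i \<in> I \<Longrightarrow> Ck_on k S (f i)) \<Longrightarrow> Ck_on k S (\<lambda>x. \<Sum>i\<in>I. f i x)"
  by (induct I rule: finite_induct) (auto intro: Ck_on_const Ck_on_add)

lemma Ck_on_mult:
  fixes f g :: "'a::real_normed_vector \<Rightarrow> real"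
  shows "open S \<Longrightarrow> Ck_on k S f \<Longrightarrow> Ck_on k S g \<Longrightarrow> Ck_on k S (\<lambda>x. f x * g x)"
proof (induction k arbitrary: f g)
  case (Suc k)
  note f = Suc.prems(2) and g = Suc.prems(3)
  show ?case
  proof (rule Ck_on_SucI)
    show "((\<lambda>x. f x * g x) has_derivative
       (\<lambda>v. f x * frechet_derivative g (at x) v + frechet_derivative f (at x) v * g x)) (at x)" if "x \<in> S" for x
      using f g that by (intro has_derivative_mult) (auto simp: frechet_derivative_works[THEN iffD1])
    show "Ck_on k S (\<lambda>x. f x * frechet_derivative g (at x) v + frechet_derivative f (at x) v * g x)" for v
      using f g Ck_on_SucD[OF f] Ck_on_SucD[OF g] Suc by (intro Ck_on_add Suc.IH) auto
  qed fact
qed (auto intro: continuous_intros)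

lemma Ck_on_prod:
  fixes f :: "'i \<Rightarrow> 'a::real_normed_vector \<Rightarrow> real"
  shows "finite I \<Longrightarrow> open S \<Longrightarrow> (\<And>i. i \<in> I \<Longrightarrow> Ck_on k S (f i)) \<Longrightarrow> Ck_on k S (\<lambda>x. \<Prod>i\<in>I. f i x)"
  by (induct I rule: finite_induct) (auto intro: Ck_on_const Ck_on_mult)

section \<open>Parseval frames\<close>

text \<open>The model space is finite-dimensional without being an instance of
  \<^class>\<open>euclidean_space\<close>, so a basis has to be carried along explicitly.  An orthonormal basis
  satisfies this condition, and the reconstruction formula is all that the later arguments draw from it.\<close>
definition parseval_frame :: "'e::real_inner set \<Rightarrow> bool" where
  "parseval_frame B \<longleftrightarrow> finite B \<and> (\<forall>v. (\<Sum>b\<in>B. (v \<bullet> b) *\<^sub>R b) = v)"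

lemma parseval_frame_real: "parseval_frame {1::real}"
  by (simp add: parseval_frame_def)

text \<open>Gram-Schmidt gives an orthogonal spanning set; normalise it.  The difference of \<open>v\<close> and
  its Fourier expansion is orthogonal to every member, hence to itself.\<close>
lemma parseval_frame_exists:
  fixes S :: "'e::real_inner set"
  assumes "finite S" "span S = UNIV"
  obtains B :: "'e set" where "parseval_frame B"
proof -
  obtain C :: "'e set" where C: "finite C" "span C = UNIV" "pairwise orthogonal C"
    using basis_orthogonal[OF assms(1)] assms(2) by metis
  define D where "D = C - {0}"
  have D: "finite D" "span D = UNIV" "pairwise orthogonal D"
    using C by (auto simp: D_def intro: pairwise_subset)
  define e where "e = (\<lambda>x::'e. x /\<^sub>R norm x)"
  have inj: "inj_on e D"
  proof (rule inj_onI, rule ccontr)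
    fix x y assume xy: "x \<in> D" "y \<in> D" "e x = e y" "x \<noteq> y"
    then have "x \<bullet> y = 0" using D(3) by (auto simp: pairwise_def orthogonal_def)
    then have "e x \<bullet> e y = 0" by (simp add: e_def)
    then have "e x = 0" using xy(3) by simp
    then show False using xy by (auto simp: e_def D_def)
  qed
  have "(\<Sum>b\<in>e ` D. (v \<bullet> b) *\<^sub>R b) = v" for v
  proof -
    define w where "w = (\<Sum>x\<in>D. (v \<bullet> e x) *\<^sub>R e x)"
    \<comment> \<open>The Fourier expansion has the same inner products with \<open>D\<close> as \<open>v\<close> itself.\<close>
    have "orthogonal (v - w) y" if "y \<in> D" for y
    proof -
      have "w \<bullet> y = (\<Sum>x\<in>D. if x = y then v \<bullet> y else 0)"
        unfolding w_def inner_sum_left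
      proof (rule sum.cong[OF refl])
        fix x assume "x \<in> D"
        show "((v \<bullet> e x) *\<^sub>R e x) \<bullet> y = (if x = y then v \<bullet> y else 0)"
        proof (cases "x = y")
          case True
          then have "x \<noteq> 0" using \<open>x \<in> D\<close> by (auto simp: D_def)
          then show ?thesis using True
            by (simp add: e_def field_simps power2_norm_eq_inner[symmetric] power2_eq_square)
        next
          case False
          then have "x \<bullet> y = 0" using D(3) \<open>x \<in> D\<close> that by (auto simp: pairwise_def orthogonal_def)
          then show ?thesis using False by (simp add: e_def)
        qed
      qed
      also have "\<dots> = v \<bullet> y" using that D(1) by simp
      finally show ?thesis by (simp add: orthogonal_def inner_diff_left)
    qed
    then have "orthogonal (v - w) (v - w)"
      using orthogonal_to_span[of "v - w" D "v - w"] D(2) by auto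
    then have "w = v" by (simp add: orthogonal_self)
    then show ?thesis by (simp add: w_def sum.reindex[OF inj])
  qed
  then have "parseval_frame (e ` D)" using D(1) by (simp add: parseval_frame_def)
  then show ?thesis by (rule that)
qed

lemma parseval_frame_linear:
  fixes B :: "'b::real_inner set" and f :: "'b \<Rightarrow> 'c::real_vector"
  assumes "parseval_frame B" "linear f"
  shows "f v = (\<Sum>b\<in>B. (v \<bullet> b) *\<^sub>R f b)"
proof -
  have "f v = f (\<Sum>b\<in>B. (v \<bullet> b) *\<^sub>R b)" using assms(1) by (simp add: parseval_frame_def)
  then show ?thesis using assms(2) by (simp add: linear_sum linear_scale)
qed

lemma parseval_frame_bounded_linear:
  fixes B :: "'b::real_inner set" and f :: "'b \<Rightarrow> 'c::real_normed_vector"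
  assumes "parseval_frame B" "linear f"
  shows "bounded_linear f"
proof -
  have "f = (\<lambda>v. \<Sum>b\<in>B. (v \<bullet> b) *\<^sub>R f b)" using parseval_frame_linear[OF assms] by blast
  moreover have "bounded_linear (\<lambda>v. \<Sum>b\<in>B. (v \<bullet> b) *\<^sub>R f b)"
    by (intro bounded_linear_sum bounded_linear_scaleR_left[THEN bounded_linear_compose]
        bounded_linear_inner_left)
  ultimately show ?thesis by simp
qed

text \<open>Coefficients of points of the ball are bounded, so the ball is a closed subset of a finite
  Minkowski sum of compact segments.\<close>
lemma parseval_frame_compact_cball:
  fixes x0 :: "'e::real_inner" and B :: "'e set"
  assumes "parseval_frame B"
  shows "compact (cball x0 r)"
proof -
  define R where "R = (\<lambda>b::'e. (norm x0 + r) * norm b)"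
  have fin: "finite B" using assms by (simp add: parseval_frame_def)
  have "compact {(\<Sum>b\<in>C. c b *\<^sub>R b) | c. \<forall>b\<in>C. c b \<in> {- R b..R b}}" if "finite C" for C :: "'e set"
    using that
  proof induction
    case (insert a C)
    let ?S = "\<lambda>C. {(\<Sum>b\<in>C. c b *\<^sub>R b) | c. \<forall>b\<in>C. c b \<in> {- R b..R b}}"
    have "compact ((\<lambda>c. c *\<^sub>R a) ` {- R a..R a})"
      by (intro compact_continuous_image continuous_intros compact_Icc)
    from compact_sums[OF this insert.IH]
    have "compact {x + y |x y. x \<in> (\<lambda>c. c *\<^sub>R a) ` {- R a..R a} \<and> y \<in> ?S C}" .
    moreover have "{x + y |x y. x \<in> (\<lambda>c. c *\<^sub>R a) ` {- R a..R a} \<and> y \<in> ?S C} = ?S (insert a C)"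
      (is "?L = _")
    proof (intro equalityI subsetI)
      fix z assume "z \<in> ?L"
      then obtain s c where s: "s \<in> {- R a..R a}" "\<forall>b\<in>C. c b \<in> {- R b..R b}"
        "z = s *\<^sub>R a + (\<Sum>b\<in>C. c b *\<^sub>R b)" by auto
      have "z = (\<Sum>b\<in>insert a C. (c(a := s)) b *\<^sub>R b)"
        using s insert.hyps by (auto intro!: sum.cong)
      then show "z \<in> ?S (insert a C)" using s(1,2)
        by (intro CollectI exI[of _ "c(a := s)"]) auto
    next
      fix z assume "z \<in> ?S (insert a C)"
      then obtain c where "\<forall>b\<in>insert a C. c b \<in> {- R b..R b}" "z = (\<Sum>b\<in>insert a C. c b *\<^sub>R b)"
        by auto
      then have "z = c a *\<^sub>R a + (\<Sum>b\<in>C. c b *\<^sub>R b)" "c a *\<^sub>R a \<in> (\<lambda>c. c *\<^sub>R a) ` {- R a..R a}"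
        "(\<Sum>b\<in>C. c b *\<^sub>R b) \<in> ?S C"
        using insert.hyps by auto
      then show "z \<in> ?L" by blast
    qed
    ultimately show ?case by simp
  qed auto
  from this[OF fin] have c: "compact {(\<Sum>b\<in>B. c b *\<^sub>R b) | c. \<forall>b\<in>B. c b \<in> {- R b..R b}}" .
  have "cball x0 r \<subseteq> {(\<Sum>b\<in>B. c b *\<^sub>R b) | c. \<forall>b\<in>B. c b \<in> {- R b..R b}}"
  proof
    fix v assume "v \<in> cball x0 r"
    then have "norm v \<le> norm x0 + r"
      using norm_triangle_sub[of v x0] by (simp add: dist_norm norm_minus_commute)
    then have "\<bar>v \<bullet> b\<bar> \<le> R b" for b
      using Cauchy_Schwarz_ineq2[of v b] mult_right_mono[of "norm v" "norm x0 + r" "norm b"]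
      by (simp add: R_def)
    then have "v \<bullet> b \<in> {- R b..R b}" for b unfolding atLeastAtMost_iff abs_le_iff
      by (metis abs_le_iff minus_le_iff)
    then have "\<forall>b\<in>B. v \<bullet> b \<in> {- R b..R b}" by blast
    moreover have "v = (\<Sum>b\<in>B. (v \<bullet> b) *\<^sub>R b)" using assms by (simp add: parseval_frame_def)
    ultimately show "v \<in> {(\<Sum>b\<in>B. c b *\<^sub>R b) | c. \<forall>b\<in>B. c b \<in> {- R b..R b}}" by blast
  qed
  from compact_Int_closed[OF c closed_cball, of x0 r] this show ?thesis by (simp only: Int_absorb1)
qed

section \<open>Composition with smooth functions\<close>

lemma Ck_on_inner_left:
  fixes f :: "'a::real_normed_vector \<Rightarrow> 'b::real_inner"
  shows "open S \<Longrightarrow> Ck_on k S f \<Longrightarrow> Ck_on k S (\<lambda>x. f x \<bullet> b)"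
proof (induction k arbitrary: f)
  case (Suc k)
  show ?case
  proof (rule Ck_on_SucI)
    show "((\<lambda>x. f x \<bullet> b) has_derivative (\<lambda>v. frechet_derivative f (at x) v \<bullet> b)) (at x)" if "x \<in> S" for x
      using Suc.prems(2) that by (intro has_derivative_inner_left) (simp add: frechet_derivative_works[THEN iffD1])
    show "Ck_on k S (\<lambda>x. frechet_derivative f (at x) v \<bullet> b)" for v
      using Suc.prems by (intro Suc.IH) auto
  qed fact
qed (auto intro: continuous_intros)

text \<open>The chain rule expresses the derivative of \<open>g \<circ> f\<close> by \<open>frechet_derivative g\<close> at \<open>f x\<close>
  in a direction that itself depends on \<open>x\<close>.  Expanding that direction in the frame leaves a finite
  sum of products of functions to which the induction hypothesis applies.\<close>
lemma Ck_on_comp: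
  fixes f :: "'a::real_normed_vector \<Rightarrow> 'b::real_inner" and g :: "'b \<Rightarrow> real" and B :: "'b set"
  assumes B: "parseval_frame B" and S: "open S" and T: "open T" and fST: "f ` S \<subseteq> T"
  shows "Ck_on k S f \<Longrightarrow> Ck_on k T g \<Longrightarrow> Ck_on k S (g \<circ> f)"
proof (induction k arbitrary: g)
  case 0
  then show ?case using fST continuous_on_compose[of S f g] continuous_on_subset[of T g "f ` S"] by simp
next
  case (Suc k)
  note f = Suc.prems(1) and g = Suc.prems(2)
  have fx: "(f has_derivative frechet_derivative f (at x)) (at x)" if "x \<in> S" for x
    using f that by (auto simp: frechet_derivative_works[THEN iffD1])
  have gx: "(g has_derivative frechet_derivative g (at y)) (at y)" if "y \<in> T" for y
    using g that by (auto simp: frechet_derivative_works[THEN iffD1])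
  show ?case
  proof (rule Ck_on_SucI)
    fix x assume x: "x \<in> S"
    then have y: "f x \<in> T" using fST by auto
    have lin: "linear (frechet_derivative g (at (f x)))" using gx[OF y] has_derivative_linear by blast
    have "(g \<circ> f has_derivative frechet_derivative g (at (f x)) \<circ> frechet_derivative f (at x)) (at x)"
      using diff_chain_at[OF fx[OF x] gx[OF y]] .
    moreover have "frechet_derivative g (at (f x)) \<circ> frechet_derivative f (at x) =
      (\<lambda>v. \<Sum>b\<in>B. (frechet_derivative f (at x) v \<bullet> b) * frechet_derivative g (at (f x)) b)"
      by (rule ext) (simp only: o_apply parseval_frame_linear[OF B lin, symmetric] flip: real_scaleR_def)
    ultimately show "(g \<circ> f has_derivative
      (\<lambda>v. \<Sum>b\<in>B. (frechet_derivative f (at x) v \<bullet> b) * frechet_derivative g (at (f x)) b)) (at x)"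
      by simp
  next
    fix v
    have "Ck_on k S (\<lambda>x. frechet_derivative f (at x) v \<bullet> b)" for b
      using f by (intro Ck_on_inner_left S) simp
    moreover have "Ck_on k S (\<lambda>x. frechet_derivative g (at (f x)) b)" for b
      using Suc.IH[OF Ck_on_SucD[OF f], of "\<lambda>y. frechet_derivative g (at y) b"] g
      by (simp add: comp_def)
    ultimately show "Ck_on k S (\<lambda>x. \<Sum>b\<in>B. (frechet_derivative f (at x) v \<bullet> b) *
       frechet_derivative g (at (f x)) b)"
      using B S by (intro Ck_on_sum Ck_on_mult) (auto simp: parseval_frame_def)
  qed fact
qed

section \<open>Smooth cutoff functions\<close>

text \<open>The case \<open>m = 0\<close> is the classical smooth function vanishing to infinite order at \<open>0\<close>.  The
  extra powers make the family closed under differentiation up to linear combinations.\<close>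
definition flat_exp :: "nat \<Rightarrow> real \<Rightarrow> real" where
  "flat_exp m x = (if x > 0 then inverse x ^ m * exp (- inverse x) else 0)"

lemma flat_exp_tendsto_0: "(flat_exp m \<longlongrightarrow> 0) (at 0)"
proof -
  have "((\<lambda>x. inverse x ^ m / exp (inverse x)) \<longlongrightarrow> 0) (at_right (0::real))"
    using filterlim_compose[OF tendsto_power_div_exp_0 filterlim_inverse_at_top_right] .
  then have "(flat_exp m \<longlongrightarrow> 0) (at_right 0)"
    by (rule Lim_transform_eventually)
       (auto simp: flat_exp_def exp_minus field_simps intro!: eventually_at_right_less[THEN eventually_mono])
  moreover have "(flat_exp m \<longlongrightarrow> 0) (at_left 0)"
    by (rule Lim_transform_eventually[OF tendsto_const])
       (auto simp: flat_exp_def eventually_at_filter)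
  ultimately show ?thesis by (simp add: filterlim_split_at)
qed

text \<open>At \<open>0\<close> the difference quotient of \<open>flat_exp m\<close> is \<open>flat_exp (m + 1)\<close>, which tends to \<open>0\<close>.\<close>
lemma flat_exp_has_derivative:
  "(flat_exp m has_derivative (\<lambda>v. v * (flat_exp (m + 2) x - real m * flat_exp (m + 1) x))) (at x)"
proof -
  consider "x < 0" | "x = 0" | "x > 0" by linarith
  then have "(flat_exp m has_field_derivative (flat_exp (m + 2) x - real m * flat_exp (m + 1) x)) (at x)"
  proof cases
    case 1
    have "((\<lambda>_. 0::real) has_field_derivative 0) (at x)" by simp
    then have "(flat_exp m has_field_derivative 0) (at x)"
      by (rule DERIV_cong_ev[THEN iffD1, rotated -1])
         (use 1 in \<open>auto simp: flat_exp_def intro: eventually_mono[OF order_tendstoD(2)[OF tendsto_ident_at]]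
            intro!: eventually_nhds_in_open[of "{..<0}", THEN eventually_mono]\<close>)
    then show ?thesis using 1 by (simp add: flat_exp_def)
  next
    case 2
    have "((\<lambda>y. (flat_exp m y - flat_exp m 0) / (y - 0)) \<longlongrightarrow> 0) (at 0)"
      by (rule Lim_transform_eventually[OF flat_exp_tendsto_0[of "Suc m"]])
         (auto simp: flat_exp_def eventually_at_filter field_simps)
    then show ?thesis using 2 by (simp add: has_field_derivative_iff flat_exp_def)
  next
    case 3
    have pow: "real m * inverse x ^ (m - 1) * inverse x ^ 2 = real m * inverse x ^ (m + 1)"
      by (cases m) (simp_all add: power_add[symmetric])
    have "((\<lambda>y. inverse y ^ m * exp (- inverse y)) has_field_derivative
       (real m * inverse x ^ (m - 1) * - (inverse x ^ 2)) * exp (- inverse x) +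
       (exp (- inverse x) * inverse x ^ 2) * inverse x ^ m) (at x)"
      using 3 by (auto intro!: derivative_eq_intros simp: power2_eq_square)
    also have "(real m * inverse x ^ (m - 1) * - (inverse x ^ 2)) * exp (- inverse x) +
       (exp (- inverse x) * inverse x ^ 2) * inverse x ^ m =
       flat_exp (m + 2) x - real m * flat_exp (m + 1) x"
      unfolding mult_minus_right pow[unfolded mult.assoc[symmetric]] using 3
      by (simp add: flat_exp_def power_add power2_eq_square algebra_simps)
    finally have "((\<lambda>y. inverse y ^ m * exp (- inverse y)) has_field_derivative
       (flat_exp (m + 2) x - real m * flat_exp (m + 1) x)) (at x)" .
    then show ?thesis
      by (rule DERIV_cong_ev[THEN iffD1, rotated -1])
         (use 3 in \<open>auto simp: flat_exp_def intro!: eventually_nhds_in_open[of "{0<..}", THEN eventually_mono]\<close>)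
  qed
  then show ?thesis by (simp add: has_field_derivative_def mult_commute_abs)
qed

lemma Ck_on_flat_exp: "Ck_on k UNIV (flat_exp m)"
proof (induction k arbitrary: m)
  case 0
  show ?case
    using has_derivative_continuous[OF flat_exp_has_derivative[of m]] by (simp add: continuous_on_eq_continuous_within)
next
  case (Suc k)
  have e: "v * (flat_exp (m + 2) x - real m * flat_exp (m + 1) x) =
     v * flat_exp (m + 2) x + (- v * real m) * flat_exp (m + 1) x" for v x
    by (simp add: algebra_simps)
  show ?case
    by (rule Ck_on_SucI[OF _ flat_exp_has_derivative], simp, unfold e)
       (intro Ck_on_add Ck_on_mult Ck_on_const Suc open_UNIV)
qed

text \<open>The function \<open>\<theta>(y) = flat_exp 0 (|y - x0|\<^sup>2 - r\<^sup>2/4)\<close> is \<open>0\<close>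
  on the half ball and at least \<open>c\<close> outside the ball, so that \<open>flat_exp 0 (c - \<theta>(y))\<close>
  is constant on the former and \<open>0\<close> on the latter; scaling makes the constant \<open>1\<close>.\<close>
lemma smooth_cutoff_exists:
  fixes x0 :: "'e::real_inner"
  assumes "r > 0"
  obtains \<eta> :: "'e \<Rightarrow> real" where "smooth_on UNIV \<eta>"
    "\<And>y. y \<in> ball x0 (r / 2) \<Longrightarrow> \<eta> y = 1" "\<And>y. y \<notin> cball x0 r \<Longrightarrow> \<eta> y = 0"
proof -
  define q where "q = (\<lambda>y. (y - x0) \<bullet> (y - x0))"
  define c where "c = flat_exp 0 (3 * r\<^sup>2 / 4)"
  define \<eta> where "\<eta> = (\<lambda>y. flat_exp 0 (c - flat_exp 0 (q y - r\<^sup>2 / 4)) * inverse (flat_exp 0 c))"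
  have c: "c > 0" "flat_exp 0 c > 0" using assms by (auto simp: c_def flat_exp_def)
  have qn: "q y = (dist x0 y)\<^sup>2" for y
    by (simp add: q_def dot_square_norm dist_norm norm_minus_commute)
  have q: "Ck_on k UNIV q" for k
  proof (cases k)
    case (Suc j)
    have lin: "Ck_on j UNIV (\<lambda>y. 2 * (y \<bullet> v) + (- 2 * (x0 \<bullet> v)))" for v :: 'e
      by (intro Ck_on_add Ck_on_const open_UNIV Ck_on_bounded_linear bounded_linear_const_mult
          bounded_linear_inner_left)
    have "(q has_derivative (\<lambda>v. 2 * (y \<bullet> v) + (- 2 * (x0 \<bullet> v)))) (at y)" for y
      unfolding q_def by (auto intro!: derivative_eq_intros simp: algebra_simps inner_commute)
    then show ?thesis unfolding Suc by (rule Ck_on_SucI[OF open_UNIV]) (rule lin)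
  qed (auto simp: q_def intro!: continuous_intros)
  have "Ck_on k UNIV \<eta>" for k
  proof -
    have 1: "Ck_on k UNIV (\<lambda>y. q y + (- r\<^sup>2 / 4))" by (intro Ck_on_add q Ck_on_const open_UNIV)
    have 2: "Ck_on k UNIV (\<lambda>y. flat_exp 0 (q y - r\<^sup>2 / 4))"
      using Ck_on_comp[OF parseval_frame_real open_UNIV open_UNIV _ 1 Ck_on_flat_exp[of k 0]]
      by (simp add: comp_def)
    have 3: "Ck_on k UNIV (\<lambda>y. c + (- 1) * flat_exp 0 (q y - r\<^sup>2 / 4))"
      by (intro Ck_on_add Ck_on_mult 2 Ck_on_const open_UNIV)
    have 4: "Ck_on k UNIV (\<lambda>y. flat_exp 0 (c - flat_exp 0 (q y - r\<^sup>2 / 4)))"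
      using Ck_on_comp[OF parseval_frame_real open_UNIV open_UNIV _ 3 Ck_on_flat_exp[of k 0]]
      by (simp add: comp_def)
    show ?thesis unfolding \<eta>_def by (intro Ck_on_mult 4 Ck_on_const open_UNIV)
  qed
  moreover have "\<eta> y = 1" if "y \<in> ball x0 (r / 2)" for y
  proof -
    have "q y \<le> (r / 2)\<^sup>2" unfolding qn using that by (intro power_mono) auto
    then have "flat_exp 0 (q y - r\<^sup>2 / 4) = 0" by (simp add: flat_exp_def power_divide)
    then show ?thesis using c by (simp add: \<eta>_def)
  qed
  moreover have "\<eta> y = 0" if "y \<notin> cball x0 r" for y
  proof -
    have "r\<^sup>2 \<le> q y" unfolding qn using that assms by (intro power_mono) auto
    then have "3 * r\<^sup>2 / 4 \<le> q y - r\<^sup>2 / 4" by simp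
    moreover have "0 < 3 * r\<^sup>2 / 4" using assms by simp
    moreover have "flat_exp 0 s \<le> flat_exp 0 s'" if "0 < s" "s \<le> s'" for s s'
      using that le_imp_inverse_le[of s s'] by (simp add: flat_exp_def)
    ultimately have "c \<le> flat_exp 0 (q y - r\<^sup>2 / 4)"
      unfolding c_def by blast
    then show ?thesis by (simp add: \<eta>_def flat_exp_def)
  qed
  ultimately show ?thesis using that by (auto simp: smooth_on_def)
qed

section \<open>Brackets on a vector space in terms of components\<close>

lemma chart_at_flat [simp]: "chart_at flat_atlas p = (UNIV, id)"
  unfolding chart_at_def flat_atlas_def by (rule some_equality) auto

lemma tangent_map_flat:
  "tangent_map flat_atlas flat_atlas f p = Blinfun (frechet_derivative f (at p))"
  by (simp add: tangent_map_def)

text \<open>The differential in the sense of \<^const>\<open>flat_atlas\<close>.\<close>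
definition gradient :: "'e::real_normed_vector \<Rightarrow> ('e \<Rightarrow> real) \<Rightarrow> 'e \<Rightarrow>\<^sub>L real" where
  "gradient y f = Blinfun (frechet_derivative f (at y))"

lemma gradient_apply: "f differentiable (at y) \<Longrightarrow> blinfun_apply (gradient y f) = frechet_derivative f (at y)"
  unfolding gradient_def
  by (rule bounded_linear_Blinfun_apply) (rule has_derivative_bounded_linear[OF frechet_derivative_works[THEN iffD1]])

lemma tensor_bracket_flat: "tensor_bracket flat_atlas T fs y = T y (map (gradient y) fs)"
  unfolding tensor_bracket_def tangent_map_flat gradient_def ..

lemma smooth_functions_flat: "f \<in> smooth_functions flat_atlas \<longleftrightarrow> smooth_on UNIV f"
proof -
  have "smooth_on UNIV f \<Longrightarrow> continuous_on UNIV f"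
    unfolding smooth_on_def by (metis Ck_on.simps(1))
  then show ?thesis by (auto simp: smooth_functions_def smooth_map_def flat_atlas_def)
qed

lemma smooth_on_differentiable: "smooth_on S f \<Longrightarrow> x \<in> S \<Longrightarrow> f differentiable (at x)"
  unfolding smooth_on_def by (metis Ck_on.simps(2))

lemma skew_multilinear_slot_linear:
  assumes "T \<in> multivectors n" "length \<alpha>s = n" "i < n"
  shows "linear (\<lambda>\<beta>. T (\<alpha>s[i := \<beta>]))"
  using assms by (simp add: multivectors_def skew_multilinear_def)

lemma parseval_frame_covector:
  fixes B :: "'e::real_inner set" and \<beta> :: "'e \<Rightarrow>\<^sub>L real"
  assumes "parseval_frame B"
  shows "\<beta> = (\<Sum>b\<in>B. \<beta> b *\<^sub>R blinfun_inner_right b)"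
proof (rule blinfun_eqI)
  fix v
  have "\<beta> v = (\<Sum>b\<in>B. (v \<bullet> b) *\<^sub>R \<beta> b)"
    using parseval_frame_linear[OF assms, of \<beta> v] by (simp add: blinfun.bounded_linear_right bounded_linear.linear)
  then show "\<beta> v = (\<Sum>b\<in>B. \<beta> b *\<^sub>R blinfun_inner_right b) v"
    by (simp add: blinfun.sum_left blinfun.scaleR_left inner_commute mult.commute)
qed

lemma multivector_expand_slot:
  fixes B :: "'e::real_inner set"
  assumes "parseval_frame B" "T \<in> multivectors n" "length \<alpha>s = n" "i < n"
  shows "T (\<alpha>s[i := \<beta>]) = (\<Sum>b\<in>B. \<beta> b * T (\<alpha>s[i := blinfun_inner_right b]))"
proof -
  note lin = skew_multilinear_slot_linear[OF assms(2,3,4)]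
  have "T (\<alpha>s[i := \<beta>]) = T (\<alpha>s[i := \<Sum>b\<in>B. \<beta> b *\<^sub>R blinfun_inner_right b])"
    using parseval_frame_covector[OF assms(1), of \<beta>] by simp
  also have "\<dots> = (\<Sum>b\<in>B. \<beta> b *\<^sub>R T (\<alpha>s[i := blinfun_inner_right b]))"
    by (simp only: linear_sum[OF lin] linear_scale[OF lin])
  finally show ?thesis by simp
qed

definition frame_lists :: "nat \<Rightarrow> 'e set \<Rightarrow> 'e list set" where
  "frame_lists n B = {bs. set bs \<subseteq> B \<and> length bs = n}"

text \<open>A multivector is determined by its components in a frame.  The slots are expanded one
  after the other, \<open>m\<close> counting those already treated.\<close>
lemma multivector_expand:
  fixes B :: "'e::real_inner set"
  assumes B: "parseval_frame B" and T: "T \<in> multivectors n" and len: "length \<alpha>s = n"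
  shows "T \<alpha>s = (\<Sum>bs\<in>frame_lists n B. (\<Prod>k<n. (\<alpha>s ! k) (bs ! k)) * T (map blinfun_inner_right bs))"
proof -
  have "T \<alpha>s = (\<Sum>bs\<in>frame_lists m B. (\<Prod>k<m. (\<alpha>s ! k) (bs ! k)) *
    T (map blinfun_inner_right bs @ drop m \<alpha>s))" if "m \<le> n" for m
    using that
  proof (induction m)
    case 0
    then show ?case by (simp add: frame_lists_def conj_commute cong: conj_cong)
  next
    case (Suc m)
    have step: "T (map blinfun_inner_right bs @ drop m \<alpha>s) =
      (\<Sum>b\<in>B. (\<alpha>s ! m) b * T (map blinfun_inner_right (bs @ [b]) @ drop (Suc m) \<alpha>s))"
      if "bs \<in> frame_lists m B" for bs
    proof -
      let ?\<beta>s = "map blinfun_inner_right bs @ drop m \<alpha>s"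
      have l: "length bs = m" using that by (simp add: frame_lists_def)
      have d: "drop m \<alpha>s = \<alpha>s ! m # drop (Suc m) \<alpha>s"
        using Suc.prems len by (simp add: Cons_nth_drop_Suc)
      have upd: "?\<beta>s[m := \<beta>] = map blinfun_inner_right bs @ \<beta> # drop (Suc m) \<alpha>s" for \<beta>
        unfolding d using l by (simp add: list_update_append)
      have "T (?\<beta>s[m := \<alpha>s ! m]) = (\<Sum>b\<in>B. (\<alpha>s ! m) b * T (?\<beta>s[m := blinfun_inner_right b]))"
        by (rule multivector_expand_slot[OF B T]) (use l len Suc.prems in auto)
      then show ?thesis unfolding upd by (simp add: d)
    qed
    have "T \<alpha>s = (\<Sum>bs\<in>frame_lists m B. \<Sum>b\<in>B. (\<Prod>k<m. (\<alpha>s ! k) (bs ! k)) * ((\<alpha>s ! m) b *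
        T (map blinfun_inner_right (bs @ [b]) @ drop (Suc m) \<alpha>s)))"
      using Suc step by (simp add: sum_distrib_left cong: sum.cong)
    also have "\<dots> = (\<Sum>(bs, b)\<in>frame_lists m B \<times> B. (\<Prod>k<m. (\<alpha>s ! k) (bs ! k)) * ((\<alpha>s ! m) b *
        T (map blinfun_inner_right (bs @ [b]) @ drop (Suc m) \<alpha>s)))"
      by (simp add: sum.cartesian_product)
    also have "\<dots> = (\<Sum>bs\<in>frame_lists (Suc m) B. (\<Prod>k<Suc m. (\<alpha>s ! k) (bs ! k)) *
        T (map blinfun_inner_right bs @ drop (Suc m) \<alpha>s))"
    proof (rule sum.reindex_bij_witness[where j = "\<lambda>(bs, b). bs @ [b]" and i = "\<lambda>bs. (butlast bs, last bs)"])
      fix bs assume bs: "bs \<in> frame_lists (Suc m) B"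
      then have ne: "bs \<noteq> []" by (auto simp: frame_lists_def)
      then show "(case (butlast bs, last bs) of (bs, b) \<Rightarrow> bs @ [b]) = bs" by simp
      show "(butlast bs, last bs) \<in> frame_lists m B \<times> B"
        using bs ne by (auto simp: frame_lists_def dest: in_set_butlastD)
    next
      fix a assume a: "a \<in> frame_lists m B \<times> B"
      obtain bs b where ab: "a = (bs, b)" by (cases a)
      have l: "length bs = m" using a ab by (simp add: frame_lists_def)
      show "(butlast (case a of (bs, b) \<Rightarrow> bs @ [b]), last (case a of (bs, b) \<Rightarrow> bs @ [b])) = a"
        by (simp add: ab)
      show "(case a of (bs, b) \<Rightarrow> bs @ [b]) \<in> frame_lists (Suc m) B"
        using a ab by (auto simp: frame_lists_def)
      have "(\<Prod>k<m. (\<alpha>s ! k) ((bs @ [b]) ! k)) = (\<Prod>k<m. (\<alpha>s ! k) (bs ! k))"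
        by (rule prod.cong) (auto simp: nth_append l)
      then show "(\<Prod>k<Suc m. (\<alpha>s ! k) ((case a of (bs, b) \<Rightarrow> bs @ [b]) ! k)) *
         T (map blinfun_inner_right (case a of (bs, b) \<Rightarrow> bs @ [b]) @ drop (Suc m) \<alpha>s) =
         (case a of (bs, b) \<Rightarrow> (\<Prod>k<m. (\<alpha>s ! k) (bs ! k)) * ((\<alpha>s ! m) b *
           T (map blinfun_inner_right (bs @ [b]) @ drop (Suc m) \<alpha>s)))"
        using l by (simp add: ab nth_append)
    qed
    finally show ?case .
  qed
  from this[of n] show ?thesis using len by simp
qed

text \<open>The factor of the component \<open>bs\<close> of \<open>T\<close> when the bracket of \<open>fs\<close> is expanded in
  a frame; it depends on the functions but not on the tensor field.\<close>
definition jet_coeff :: "('e::real_normed_vector \<Rightarrow> real) list \<Rightarrow> 'e list \<Rightarrow> 'e \<Rightarrow> real" where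
  "jet_coeff fs bs y = (\<Prod>k<length fs. frechet_derivative (fs ! k) (at y) (bs ! k))"

lemma tensor_bracket_flat_expand:
  fixes B :: "'e::real_inner set"
  assumes "parseval_frame B" "T y \<in> multivectors n" "length fs = n"
    and "\<And>f. f \<in> set fs \<Longrightarrow> f differentiable (at y)"
  shows "tensor_bracket flat_atlas T fs y =
    (\<Sum>bs\<in>frame_lists n B. jet_coeff fs bs y * T y (map blinfun_inner_right bs))"
proof -
  have "(map (gradient y) fs ! k) v = frechet_derivative (fs ! k) (at y) v" if "k < n" for k v
    using that assms(3,4) by (simp add: gradient_apply)
  then show ?thesis
    unfolding tensor_bracket_flat jet_coeff_def
    using multivector_expand[OF assms(1,2), of "map (gradient y) fs"] assms(3) by simp
qed

lemma jet_coeff_smooth: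
  assumes "\<And>f. f \<in> set fs \<Longrightarrow> smooth_on UNIV f"
  shows "smooth_on UNIV (jet_coeff fs bs)"
  unfolding smooth_on_def jet_coeff_def
proof (intro allI Ck_on_prod)
  fix k i assume "i \<in> {..<length fs}"
  then have "Ck_on (Suc k) UNIV (fs ! i)" using assms by (simp add: smooth_on_def del: Ck_on.simps)
  then show "Ck_on k UNIV (\<lambda>y. frechet_derivative (fs ! i) (at y) (bs ! i))" by simp
qed auto

text \<open>The expansion turns a bracket into a finite sum of products of a smooth function and a
  component of the tensor field, so its derivative at \<open>y\<close> is an explicit expression in the values there of the
  components and of their first derivatives, in which limits can be taken term by term.\<close>
lemma tensor_bracket_flat_has_derivative:
  fixes B :: "'e::real_inner set"
  assumes B: "parseval_frame B" and T: "\<And>y. T y \<in> multivectors n" and len: "length fs = n"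
    and fs: "\<And>f. f \<in> set fs \<Longrightarrow> smooth_on UNIV f"
    and T': "\<And>\<alpha>s. length \<alpha>s = n \<Longrightarrow> ((\<lambda>y. T y \<alpha>s) has_derivative T' \<alpha>s) (at y)"
  shows "(tensor_bracket flat_atlas T fs has_derivative
    (\<lambda>v. \<Sum>bs\<in>frame_lists n B. jet_coeff fs bs y * T' (map blinfun_inner_right bs) v +
       frechet_derivative (jet_coeff fs bs) (at y) v * T y (map blinfun_inner_right bs))) (at y)"
proof -
  have "tensor_bracket flat_atlas T fs =
    (\<lambda>y. \<Sum>bs\<in>frame_lists n B. jet_coeff fs bs y * T y (map blinfun_inner_right bs))"
    by (rule ext) (rule tensor_bracket_flat_expand[OF B T len smooth_on_differentiable[OF fs UNIV_I]])
  moreover have "((\<lambda>y. jet_coeff fs bs y * T y (map blinfun_inner_right bs)) has_derivative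
    (\<lambda>v. jet_coeff fs bs y * T' (map blinfun_inner_right bs) v +
       frechet_derivative (jet_coeff fs bs) (at y) v * T y (map blinfun_inner_right bs))) (at y)"
    if "bs \<in> frame_lists n B" for bs
    using that jet_coeff_smooth[of fs, OF fs] T'
    by (intro has_derivative_mult frechet_derivative_works[THEN iffD1])
       (auto simp: frame_lists_def intro: smooth_on_differentiable)
  ultimately show ?thesis by (simp add: has_derivative_sum)
qed

section \<open>Linearization at a zero\<close>

lemma sum_pointwise:
  fixes F :: "'i \<Rightarrow> 'a \<Rightarrow> 'b::comm_monoid_add"
  shows "(\<Sum>i\<in>I. F i) x = (\<Sum>i\<in>I. F i x)"
  by (induction I rule: infinite_finite_induct) auto

text \<open>The Filippov identity for \<open>T\<close> at one point.  Localising it allows \<open>T\<close> to be a tensor field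
  whose values are meaningful only on the image of a chart.\<close>
definition filippov_at :: "nat \<Rightarrow> ('e::real_normed_vector \<Rightarrow> 'e tensor) \<Rightarrow> 'e \<Rightarrow> bool" where
  "filippov_at n T y \<longleftrightarrow>
     (\<forall>fs gs. length fs = n - 1 \<and> length gs = n \<and> (\<forall>f\<in>set fs \<union> set gs. smooth_on UNIV f) \<longrightarrow>
        tensor_bracket flat_atlas T (fs @ [tensor_bracket flat_atlas T gs]) y =
        (\<Sum>i<n. tensor_bracket flat_atlas T (gs[i := tensor_bracket flat_atlas T (fs @ [gs ! i])]) y))"

text \<open>Rescaling around \<open>x0\<close>, for \<open>t \<noteq> 0\<close>: the first derivatives of this function at \<open>x0 + t X\<close> are those of
  \<open>f\<close> at \<open>X\<close>, and its second derivatives are those of \<open>f\<close> at \<open>X\<close> divided by \<open>t\<close>.\<close>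
definition blow_up :: "'e::real_normed_vector \<Rightarrow> real \<Rightarrow> ('e \<Rightarrow> real) \<Rightarrow> 'e \<Rightarrow> real" where
  "blow_up x0 t f y = t * f ((1 / t) *\<^sub>R (y - x0))"

lemma blow_up_smooth:
  fixes x0 :: "'e::real_inner" and B :: "'e set"
  assumes "parseval_frame B" "smooth_on UNIV f"
  shows "smooth_on UNIV (blow_up x0 t f)"
  unfolding smooth_on_def
proof
  fix k
  have "Ck_on k UNIV (\<lambda>y. (1 / t) *\<^sub>R y + (- (1 / t) *\<^sub>R x0))"
    by (intro Ck_on_add Ck_on_const Ck_on_bounded_linear bounded_linear_scaleR_right open_UNIV)
  then have 1: "Ck_on k UNIV (\<lambda>y. (1 / t) *\<^sub>R (y - x0))" by (simp add: scaleR_diff_right)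
  have f: "Ck_on k UNIV f" using assms(2) by (simp add: smooth_on_def)
  have "Ck_on k UNIV (\<lambda>y. t * (f \<circ> (\<lambda>y. (1 / t) *\<^sub>R (y - x0))) y)"
    by (intro Ck_on_mult Ck_on_const open_UNIV Ck_on_comp[OF assms(1) _ _ _ 1 f]) auto
  then show "Ck_on k UNIV (blow_up x0 t f)" by (simp add: blow_up_def[abs_def] comp_def)
qed

lemma blow_up_derivative:
  assumes "t \<noteq> 0" "f differentiable (at ((1 / t) *\<^sub>R (y - x0)))"
  shows "frechet_derivative (blow_up x0 t f) (at y) = frechet_derivative f (at ((1 / t) *\<^sub>R (y - x0)))"
proof -
  let ?D = "frechet_derivative f (at ((1 / t) *\<^sub>R (y - x0)))"
  have f: "(f has_derivative ?D) (at ((1 / t) *\<^sub>R (y - x0)))"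
    using assms(2) by (rule frechet_derivative_works[THEN iffD1])
  have "((\<lambda>y. (1 / t) *\<^sub>R (y - x0)) has_derivative (\<lambda>v. (1 / t) *\<^sub>R v)) (at y)"
    by (auto intro!: derivative_eq_intros)
  from has_derivative_compose[OF this f]
  have "(blow_up x0 t f has_derivative (\<lambda>v. t * ?D ((1 / t) *\<^sub>R v))) (at y)"
    unfolding blow_up_def[abs_def] by (intro has_derivative_mult_right)
  moreover have "(\<lambda>v. t * ?D ((1 / t) *\<^sub>R v)) = ?D"
    using assms(1) linear_scale[OF has_derivative_linear[OF f]] by auto
  ultimately show ?thesis by (metis frechet_derivative_at)
qed

lemma jet_coeff_blow_up:
  assumes "t \<noteq> 0" "\<And>f. f \<in> set fs \<Longrightarrow> smooth_on UNIV f"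
  shows "jet_coeff (map (blow_up x0 t) fs) bs y = jet_coeff fs bs ((1 / t) *\<^sub>R (y - x0))"
proof -
  have "frechet_derivative (blow_up x0 t (fs ! k)) (at y) = frechet_derivative (fs ! k) (at ((1 / t) *\<^sub>R (y - x0)))"
    if "k < length fs" for k
    using that assms smooth_on_differentiable[of UNIV "fs ! k"] by (intro blow_up_derivative) auto
  then show ?thesis by (simp add: jet_coeff_def)
qed

lemma jet_coeff_blow_up_derivative:
  assumes "t \<noteq> 0" "\<And>f. f \<in> set fs \<Longrightarrow> smooth_on UNIV f"
  shows "frechet_derivative (jet_coeff (map (blow_up x0 t) fs) bs) (at (x0 + t *\<^sub>R X)) v =
    frechet_derivative (jet_coeff fs bs) (at X) v / t"
proof -
  have "jet_coeff (map (blow_up x0 t) fs) bs = (\<lambda>y. jet_coeff fs bs ((1 / t) *\<^sub>R (y - x0)))"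
    using jet_coeff_blow_up assms by blast
  moreover have "((\<lambda>y. jet_coeff fs bs ((1 / t) *\<^sub>R (y - x0))) has_derivative
     (\<lambda>v. frechet_derivative (jet_coeff fs bs) (at X) ((1 / t) *\<^sub>R v))) (at (x0 + t *\<^sub>R X))"
  proof -
    have 1: "((\<lambda>y. (1 / t) *\<^sub>R (y - x0)) has_derivative (\<lambda>v. (1 / t) *\<^sub>R v)) (at (x0 + t *\<^sub>R X))"
      by (auto intro!: derivative_eq_intros)
    have "(jet_coeff fs bs has_derivative frechet_derivative (jet_coeff fs bs) (at X)) (at X)"
      using jet_coeff_smooth[of fs, OF assms(2)]
      by (intro frechet_derivative_works[THEN iffD1] smooth_on_differentiable[of UNIV]) auto
    then have "(jet_coeff fs bs has_derivative frechet_derivative (jet_coeff fs bs) (at X))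
      (at ((1 / t) *\<^sub>R (x0 + t *\<^sub>R X - x0)))" using assms(1) by simp
    from has_derivative_compose[OF 1 this] show ?thesis .
  qed
  moreover have "linear (frechet_derivative (jet_coeff fs bs) (at X))"
    using jet_coeff_smooth[of fs, OF assms(2)]
    by (intro linear_frechet_derivative smooth_on_differentiable[of UNIV]) auto
  ultimately show ?thesis
    using linear_scale[of "frechet_derivative (jet_coeff fs bs) (at X)" "1 / t" v]
    by (simp add: frechet_derivative_at[symmetric])
qed

text \<open>A \<open>C\<^sup>1\<close> field \<open>T\<close> of multivectors on an open set \<open>N\<close> that vanishes at \<open>x0\<close>, with its
  derivative \<open>\<delta>\<close> there.\<close>
locale linearization =
  fixes B :: "'e::real_inner set" and n :: nat and T :: "'e \<Rightarrow> 'e tensor" and N :: "'e set" and x0 :: 'e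
    and \<delta> :: "'e \<Rightarrow> 'e tensor"
  assumes frame: "parseval_frame B" and multivector: "\<And>y. T y \<in> multivectors n"
    and open_N: "open N" and x0: "x0 \<in> N"
    and C1: "\<And>\<alpha>s. length \<alpha>s = n \<Longrightarrow> Ck_on 1 N (\<lambda>y. T y \<alpha>s)"
    and zero: "\<And>\<alpha>s. T x0 \<alpha>s = 0"
    and \<delta>_def: "\<And>X \<alpha>s. \<delta> X \<alpha>s = frechet_derivative (\<lambda>y. T y \<alpha>s) (at x0) X"
begin

lemma zero_outside: "length \<alpha>s \<noteq> n \<Longrightarrow> T y \<alpha>s = 0"
  using multivector by (simp add: multivectors_def)

lemma T_differentiable: "y \<in> N \<Longrightarrow> (\<lambda>y. T y \<alpha>s) differentiable (at y)"
proof (cases "length \<alpha>s = n")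
  case True
  assume "y \<in> N"
  then show ?thesis using C1[OF True] by simp
qed (simp add: zero_outside)

lemma T_has_derivative:
  "y \<in> N \<Longrightarrow> ((\<lambda>y. T y \<alpha>s) has_derivative frechet_derivative (\<lambda>y. T y \<alpha>s) (at y)) (at y)"
  using T_differentiable frechet_derivative_works by blast

lemma \<delta>_has_derivative: "((\<lambda>y. T y \<alpha>s) has_derivative (\<lambda>X. \<delta> X \<alpha>s)) (at x0)"
  using T_has_derivative[OF x0] by (simp add: \<delta>_def)

lemma \<delta>_linear: "linear (\<lambda>X. \<delta> X \<alpha>s)"
  using \<delta>_has_derivative has_derivative_linear by blast

text \<open>Linearity in a slot and skew-symmetry are linear equations between components, and these
  survive differentiation.\<close>
lemma \<delta>_multivector: "\<delta> X \<in> multivectors n"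
  unfolding multivectors_def skew_multilinear_def
proof (intro CollectI conjI allI impI)
  fix \<alpha>s :: "('e \<Rightarrow>\<^sub>L real) list" and i assume a: "length \<alpha>s = n \<and> i < n"
  have lin: "linear (\<lambda>\<beta>. T y (\<alpha>s[i := \<beta>]))" for y
    using skew_multilinear_slot_linear[OF multivector] a by blast
  show "linear (\<lambda>\<beta>. \<delta> X (\<alpha>s[i := \<beta>]))"
  proof (rule linearI)
    fix \<beta> \<gamma>
    have "((\<lambda>y. T y (\<alpha>s[i := \<beta> + \<gamma>])) has_derivative (\<lambda>X. \<delta> X (\<alpha>s[i := \<beta>]) + \<delta> X (\<alpha>s[i := \<gamma>]))) (at x0)"
      unfolding linear_add[OF lin] by (intro has_derivative_add \<delta>_has_derivative)
    from has_derivative_unique[OF this \<delta>_has_derivative]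
    show "\<delta> X (\<alpha>s[i := \<beta> + \<gamma>]) = \<delta> X (\<alpha>s[i := \<beta>]) + \<delta> X (\<alpha>s[i := \<gamma>])" by (rule fun_cong[symmetric])
  next
    fix c \<beta>
    have "((\<lambda>y. T y (\<alpha>s[i := c *\<^sub>R \<beta>])) has_derivative (\<lambda>X. c *\<^sub>R \<delta> X (\<alpha>s[i := \<beta>]))) (at x0)"
      unfolding linear_scale[OF lin] by (intro has_derivative_scaleR_right \<delta>_has_derivative)
    from has_derivative_unique[OF this \<delta>_has_derivative]
    show "\<delta> X (\<alpha>s[i := c *\<^sub>R \<beta>]) = c *\<^sub>R \<delta> X (\<alpha>s[i := \<beta>])" by (rule fun_cong[symmetric])
  qed
next
  fix \<alpha>s :: "('e \<Rightarrow>\<^sub>L real) list" and i j assume a: "length \<alpha>s = n \<and> i < n \<and> j < n \<and> i \<noteq> j"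
  have "T y (\<alpha>s[i := \<alpha>s ! j, j := \<alpha>s ! i]) = - T y \<alpha>s" for y
    using multivector[of y] a by (simp add: multivectors_def skew_multilinear_def)
  then have "((\<lambda>y. T y (\<alpha>s[i := \<alpha>s ! j, j := \<alpha>s ! i])) has_derivative (\<lambda>X. - \<delta> X \<alpha>s)) (at x0)"
    by (simp add: has_derivative_minus \<delta>_has_derivative)
  from has_derivative_unique[OF this \<delta>_has_derivative]
  show "\<delta> X (\<alpha>s[i := \<alpha>s ! j, j := \<alpha>s ! i]) = - \<delta> X \<alpha>s" by (rule fun_cong[symmetric])
next
  fix \<alpha>s :: "('e \<Rightarrow>\<^sub>L real) list" assume "length \<alpha>s \<noteq> n"
  then show "\<delta> X \<alpha>s = 0" by (simp add: \<delta>_def zero_outside)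
qed

lemma ray_tendsto: "((\<lambda>t. x0 + t *\<^sub>R X) \<longlongrightarrow> x0) (at_right 0)"
proof -
  have "((\<lambda>t. x0 + t *\<^sub>R X) \<longlongrightarrow> x0 + 0 *\<^sub>R X) (at_right 0)" by (intro tendsto_intros)
  then show ?thesis by simp
qed

text \<open>As \<open>T\<close> vanishes at \<open>x0\<close>, this is a difference quotient.\<close>
lemma T_ray_tendsto: "((\<lambda>t. T (x0 + t *\<^sub>R X) \<alpha>s / t) \<longlongrightarrow> \<delta> X \<alpha>s) (at_right 0)"
proof -
  have 1: "((\<lambda>t. x0 + t *\<^sub>R X) has_derivative (\<lambda>t. t *\<^sub>R X)) (at 0)"
    by (auto intro!: derivative_eq_intros)
  have "((\<lambda>y. T y \<alpha>s) has_derivative (\<lambda>X. \<delta> X \<alpha>s)) (at (x0 + 0 *\<^sub>R X))"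
    using \<delta>_has_derivative by simp
  from has_derivative_compose[OF 1 this]
  have "((\<lambda>t. T (x0 + t *\<^sub>R X) \<alpha>s) has_field_derivative \<delta> X \<alpha>s) (at 0)"
    unfolding has_field_derivative_def using linear_scale[OF \<delta>_linear]
    by (simp add: mult.commute[of _ "\<delta> X \<alpha>s"])
  then have "((\<lambda>t. T (x0 + t *\<^sub>R X) \<alpha>s / t) \<longlongrightarrow> \<delta> X \<alpha>s) (at 0)"
    by (simp add: DERIV_def zero)
  then show ?thesis by (rule tendsto_within_subset) simp
qed

lemma T_derivative_ray_tendsto:
  assumes "length \<alpha>s = n"
  shows "((\<lambda>t. frechet_derivative (\<lambda>y. T y \<alpha>s) (at (x0 + t *\<^sub>R X)) v) \<longlongrightarrow> \<delta> v \<alpha>s) (at_right 0)"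
proof -
  have "continuous_on N (\<lambda>y. frechet_derivative (\<lambda>y. T y \<alpha>s) (at y) v)"
    using C1[OF assms] by simp
  then have "isCont (\<lambda>y. frechet_derivative (\<lambda>y. T y \<alpha>s) (at y) v) x0"
    using open_N x0 by (simp add: continuous_on_eq_continuous_at)
  from isCont_tendsto_compose[OF this ray_tendsto] show ?thesis by (simp add: \<delta>_def)
qed

lemma eventually_ray_in_N: "eventually (\<lambda>t. x0 + t *\<^sub>R X \<in> N) (at_right 0)"
  using topological_tendstoD[OF ray_tendsto open_N x0] .

text \<open>Both sides of the Filippov identity consist of brackets in which one entry is
  again a bracket, and this lemma is their limit under rescaling.  The second derivatives of the rescaled
  functions blow up like \<open>1/t\<close>, but they are multiplied by \<open>T\<close> twice, which is of size \<open>t\<^sup>2\<close>;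
  the remaining terms contain \<open>T\<close> and its derivative, hence are of size \<open>t\<close>.  So everything
  converges after division by \<open>t\<close>.\<close>
lemma iterated_bracket_tendsto:
  assumes hs: "length hs = n" "\<And>f. f \<in> set hs \<Longrightarrow> smooth_on UNIV f"
    and ks: "length ks = n" "\<And>f. f \<in> set ks \<Longrightarrow> smooth_on UNIV f" and i: "i < n"
  shows "((\<lambda>t. tensor_bracket flat_atlas T ((map (blow_up x0 t) hs)
       [i := tensor_bracket flat_atlas T (map (blow_up x0 t) ks)]) (x0 + t *\<^sub>R X) / t)
    \<longlongrightarrow> tensor_bracket flat_atlas \<delta> (hs[i := tensor_bracket flat_atlas \<delta> ks]) X) (at_right 0)"
proof -
  let ?\<alpha>s = "map (gradient X) hs" and ?c = blinfun_inner_right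
  \<comment> \<open>\<open>?\<beta> t\<close> is the derivative of the inner bracket at \<open>x0 + t X\<close>; \<open>?\<beta>lim\<close> is its limit.
    The two summands come from differentiating \<open>T\<close> and from differentiating the arguments.\<close>
  let ?\<beta> = "\<lambda>t b. \<Sum>bs\<in>frame_lists n B.
      jet_coeff ks bs X * frechet_derivative (\<lambda>y. T y (map ?c bs)) (at (x0 + t *\<^sub>R X)) b +
      frechet_derivative (jet_coeff ks bs) (at X) b * (T (x0 + t *\<^sub>R X) (map ?c bs) / t)"
  let ?\<beta>lim = "\<lambda>b. \<Sum>bs\<in>frame_lists n B.
      jet_coeff ks bs X * \<delta> b (map ?c bs) +
      frechet_derivative (jet_coeff ks bs) (at X) b * \<delta> X (map ?c bs)"
  have ks_diff: "tensor_bracket flat_atlas \<delta> ks differentiable (at X)"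
    and ks_deriv: "frechet_derivative (tensor_bracket flat_atlas \<delta> ks) (at X) = ?\<beta>lim"
  proof -
    have "(tensor_bracket flat_atlas \<delta> ks has_derivative ?\<beta>lim) (at X)"
    proof (rule tensor_bracket_flat_has_derivative[OF frame \<delta>_multivector ks])
      show "((\<lambda>y. \<delta> y \<alpha>s) has_derivative (\<lambda>b. \<delta> b \<alpha>s)) (at X)" for \<alpha>s
        using \<delta>_has_derivative by (intro bounded_linear_imp_has_derivative) (rule has_derivative_bounded_linear)
    qed
    then show "tensor_bracket flat_atlas \<delta> ks differentiable (at X)"
      "frechet_derivative (tensor_bracket flat_atlas \<delta> ks) (at X) = ?\<beta>lim"
      using frechet_derivative_at[symmetric] by (auto simp: differentiable_def)
  qed
  have lim: "tensor_bracket flat_atlas \<delta> (hs[i := tensor_bracket flat_atlas \<delta> ks]) X =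
      (\<Sum>b\<in>B. ?\<beta>lim b * \<delta> X (?\<alpha>s[i := ?c b]))"
    unfolding tensor_bracket_flat[of \<delta> "list_update _ _ _"] map_update
    by (subst multivector_expand_slot[OF frame \<delta>_multivector])
       (use hs i in \<open>auto simp: gradient_apply[OF ks_diff] ks_deriv\<close>)
  have eq: "tensor_bracket flat_atlas T ((map (blow_up x0 t) hs)
       [i := tensor_bracket flat_atlas T (map (blow_up x0 t) ks)]) (x0 + t *\<^sub>R X) / t =
      (\<Sum>b\<in>B. ?\<beta> t b * (T (x0 + t *\<^sub>R X) (?\<alpha>s[i := ?c b]) / t))"
    if t: "t > 0" and tN: "x0 + t *\<^sub>R X \<in> N" for t
  proof -
    let ?y = "x0 + t *\<^sub>R X" and ?kt = "map (blow_up x0 t) ks"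
    have y: "(1 / t) *\<^sub>R (?y - x0) = X" using t by simp
    have sm: "\<And>f. f \<in> set ?kt \<Longrightarrow> smooth_on UNIV f" using ks(2) blow_up_smooth[OF frame] by auto
    have d: "(tensor_bracket flat_atlas T ?kt has_derivative ?\<beta> t) (at ?y)"
      using tensor_bracket_flat_has_derivative[where T = T and fs = ?kt, OF frame multivector _ sm T_has_derivative[OF tN]]
        ks t y
      by (simp add: jet_coeff_blow_up jet_coeff_blow_up_derivative)
    have g: "gradient ?y (blow_up x0 t f) = gradient X f" if "f \<in> set hs" for f
      using blow_up_derivative[of t f ?y x0] t y smooth_on_differentiable[OF hs(2)[OF that]]
      by (simp add: gradient_def)
    have "map (gradient ?y) (map (blow_up x0 t) hs) = ?\<alpha>s" using g by simp
    note grads = this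
    have "tensor_bracket flat_atlas T ((map (blow_up x0 t) hs)[i := tensor_bracket flat_atlas T ?kt]) ?y =
       T ?y (?\<alpha>s[i := gradient ?y (tensor_bracket flat_atlas T ?kt)])"
      unfolding tensor_bracket_flat[of T "list_update _ _ _"] map_update grads ..
    also have "\<dots> = (\<Sum>b\<in>B. gradient ?y (tensor_bracket flat_atlas T ?kt) b * T ?y (?\<alpha>s[i := ?c b]))"
      by (rule multivector_expand_slot[OF frame multivector]) (use hs i in auto)
    also have "blinfun_apply (gradient ?y (tensor_bracket flat_atlas T ?kt)) = ?\<beta> t"
      using d frechet_derivative_at[OF d] gradient_apply[of "tensor_bracket flat_atlas T ?kt" ?y]
      by (metis differentiable_def)
    finally show ?thesis by (simp add: sum_divide_distrib)
  qed
  have "((\<lambda>t. \<Sum>b\<in>B. ?\<beta> t b * (T (x0 + t *\<^sub>R X) (?\<alpha>s[i := ?c b]) / t)) \<longlongrightarrow>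
      (\<Sum>b\<in>B. ?\<beta>lim b * \<delta> X (?\<alpha>s[i := ?c b]))) (at_right 0)"
    by (intro tendsto_sum tendsto_mult tendsto_add tendsto_const T_ray_tendsto T_derivative_ray_tendsto)
       (simp add: frame_lists_def)
  then show ?thesis unfolding lim
  proof (rule Lim_transform_eventually)
    show "\<forall>\<^sub>F t in at_right 0. (\<Sum>b\<in>B. ?\<beta> t b * (T (x0 + t *\<^sub>R X) (?\<alpha>s[i := ?c b]) / t)) =
       tensor_bracket flat_atlas T ((map (blow_up x0 t) hs)
       [i := tensor_bracket flat_atlas T (map (blow_up x0 t) ks)]) (x0 + t *\<^sub>R X) / t"
      using eventually_ray_in_N[of X] eventually_at_right_less[of 0] by eventually_elim (simp only: eq)
  qed
qed

text \<open>Apply the identity for \<open>T\<close> at \<open>x0 + t X\<close> to rescaled functions, divide by \<open>t\<close>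
  and let \<open>t\<close> decrease to \<open>0\<close>.\<close>
lemma filippov_at_linearization:
  assumes "n \<ge> 1" and fil: "\<And>y. y \<in> N \<Longrightarrow> filippov_at n T y"
  shows "filippov_at n \<delta> X"
  unfolding filippov_at_def
proof (intro allI impI)
  fix fs gs :: "('e \<Rightarrow> real) list"
  assume a: "length fs = n - 1 \<and> length gs = n \<and> (\<forall>f\<in>set fs \<union> set gs. smooth_on UNIV f)"
  let ?E = "\<lambda>t. map (blow_up x0 t)" and ?y = "\<lambda>t. x0 + t *\<^sub>R X"
  let ?br = "tensor_bracket flat_atlas T" and ?brlim = "tensor_bracket flat_atlas \<delta>"
  \<comment> \<open>The last slot of the outer bracket on the left is filled by an update of a list of full length;
    the overwritten entry \<open>hd gs\<close> is an arbitrary smooth function.\<close>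
  have fsu: "(?E t fs @ [blow_up x0 t (hd gs)])[n - 1 := h] = ?E t fs @ [h]"
    "(fs @ [hd gs])[n - 1 := h] = fs @ [h]" for t h
    using a by (simp_all add: list_update_append)
  have hd: "hd gs \<in> set gs" using a assms(1) by (intro hd_in_set) auto
  have L: "((\<lambda>t. ?br (?E t fs @ [?br (?E t gs)]) (?y t) / t) \<longlongrightarrow> ?brlim (fs @ [?brlim gs]) X) (at_right 0)"
    using iterated_bracket_tendsto[of "fs @ [hd gs]" gs "n - 1" X] a hd assms(1)
    by (auto simp: fsu[unfolded One_nat_def])
  have "((\<lambda>t. ?br ((?E t gs)[i := ?br (?E t (fs @ [gs ! i]))]) (?y t) / t) \<longlongrightarrow>
      ?brlim (gs[i := ?brlim (fs @ [gs ! i])]) X) (at_right 0)" if "i < n" for i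
    by (rule iterated_bracket_tendsto) (use a that assms(1) in \<open>auto simp: nth_mem\<close>)
  then have R: "((\<lambda>t. \<Sum>i<n. ?br ((?E t gs)[i := ?br (?E t (fs @ [gs ! i]))]) (?y t) / t) \<longlongrightarrow>
      (\<Sum>i<n. ?brlim (gs[i := ?brlim (fs @ [gs ! i])]) X)) (at_right 0)"
    by (intro tendsto_sum) auto
  have "\<forall>\<^sub>F t in at_right 0. ?br (?E t fs @ [?br (?E t gs)]) (?y t) / t =
     (\<Sum>i<n. ?br ((?E t gs)[i := ?br (?E t (fs @ [gs ! i]))]) (?y t) / t)"
    using eventually_ray_in_N[of X]
  proof eventually_elim
    case (elim t)
    have "?br (?E t fs @ [?br (?E t gs)]) (?y t) =
      (\<Sum>i<n. ?br ((?E t gs)[i := ?br (?E t fs @ [?E t gs ! i])]) (?y t))"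
      by (rule fil[OF elim, unfolded filippov_at_def, rule_format]) (use a blow_up_smooth[OF frame] in auto)
    also have "\<dots> = (\<Sum>i<n. ?br ((?E t gs)[i := ?br (?E t (fs @ [gs ! i]))]) (?y t))"
      using a by (intro sum.cong) auto
    finally show ?case by (simp add: sum_divide_distrib)
  qed
  from Lim_transform_eventually[OF L this]
  show "?brlim (fs @ [?brlim gs]) X = (\<Sum>i<n. ?brlim (gs[i := ?brlim (fs @ [gs ! i])]) X)"
    using R by (rule tendsto_unique[OF trivial_limit_at_right_real])
qed

end

section \<open>Tensor fields and brackets in a chart\<close>

lemma smooth_manifold_chart:
  assumes "smooth_manifold A" "(U, \<phi>) \<in> A"
  shows "open U" "open (\<phi> ` U)" "homeomorphism U (\<phi> ` U) \<phi> (inv_into U \<phi>)"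
proof -
  have "\<forall>(U, \<phi>)\<in>A. open U \<and> open (\<phi> ` U) \<and> homeomorphism U (\<phi> ` U) \<phi> (inv_into U \<phi>)"
    using assms(1) by (simp add: smooth_manifold_def)
  from bspec[OF this assms(2)] show "open U" "open (\<phi> ` U)" "homeomorphism U (\<phi> ` U) \<phi> (inv_into U \<phi>)"
    by auto
qed

lemma chart_inv:
  assumes "smooth_manifold A" "(U, \<phi>) \<in> A" "p \<in> U"
  shows "inv_into U \<phi> (\<phi> p) = p"
  using homeomorphism_apply1[OF smooth_manifold_chart(3)[OF assms(1,2)] assms(3)] .

lemma open_chart_image:
  assumes A: "smooth_manifold A" "(U, \<phi>) \<in> A" and W: "open W"
  shows "open (\<phi> ` (U \<inter> W))"
proof -
  note ch = smooth_manifold_chart[OF A]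
  have "\<phi> ` (U \<inter> W) = \<phi> ` U \<inter> inv_into U \<phi> -` W" using chart_inv[OF A] by force
  then show ?thesis
    using continuous_open_preimage[OF homeomorphism_cont2[OF ch(3)] ch(2) W] by simp
qed

lemma transition_smooth:
  assumes "smooth_manifold A" "(U, \<phi>) \<in> A" "(V, \<psi>) \<in> A"
  shows "smooth_on (\<phi> ` (U \<inter> V)) (\<psi> \<circ> inv_into U \<phi>)"
proof -
  have "\<forall>(U, \<phi>)\<in>A. \<forall>(V, \<psi>)\<in>A. smooth_on (\<phi> ` (U \<inter> V)) (\<psi> \<circ> inv_into U \<phi>)"
    using assms(1) by (simp add: smooth_manifold_def)
  from bspec[OF this assms(2)] show ?thesis using assms(3) by auto
qed

lemma chart_at_chart:
  assumes "smooth_manifold A" "chart_at A p = (U, \<phi>)"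
  shows "(U, \<phi>) \<in> A" "p \<in> U"
proof -
  have "p \<in> (\<Union>(U, \<phi>)\<in>A. U)" using assms(1) by (simp add: smooth_manifold_def)
  then have "\<exists>c. c \<in> A \<and> p \<in> fst c" by force
  from someI_ex[OF this] show "(U, \<phi>) \<in> A" "p \<in> U" using assms(2) by (simp_all add: chart_at_def)
qed

text \<open>Tangent vectors at \<open>p\<close> are written in the chart selected at \<open>p\<close>, which changes with
  \<open>p\<close>.  This is the change of coordinates to one fixed chart \<open>\<phi>\<close>.\<close>
lemma tangent_map_in_chart:
  fixes A :: "('p::{t2_space, second_countable_topology}, 'e::real_inner) chart set"
    and B :: "('q, 'f::real_normed_vector) chart set"
  assumes A: "smooth_manifold A" "(U, \<phi>) \<in> A" and p: "p \<in> U" and B: "chart_at B (F p) = (V, \<psi>)"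
    and diff: "(\<psi> \<circ> F \<circ> inv_into U \<phi>) differentiable (at (\<phi> p))"
  shows "tangent_map A B F p =
    Blinfun (frechet_derivative (\<psi> \<circ> F \<circ> inv_into U \<phi>) (at (\<phi> p))) o\<^sub>L tangent_map A flat_atlas \<phi> p"
proof -
  obtain W \<theta> where ch: "chart_at A p = (W, \<theta>)" by (cases "chart_at A p")
  note W = chart_at_chart[OF A(1) ch]
  let ?G = "\<psi> \<circ> F \<circ> inv_into U \<phi>" and ?\<tau> = "\<phi> \<circ> inv_into W \<theta>"
  let ?N = "\<theta> ` (W \<inter> U)"
  have N: "open ?N" "\<theta> p \<in> ?N"
    using open_chart_image[OF A(1) W(1) smooth_manifold_chart(1)[OF A]] W(2) p by auto
  have \<tau>: "?\<tau> differentiable (at (\<theta> p))"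
    using smooth_on_differentiable[OF transition_smooth[OF A(1) W(1) A(2)] N(2)] .
  have \<tau>p: "?\<tau> (\<theta> p) = \<phi> p" using chart_inv[OF A(1) W] by simp
  have "frechet_derivative (\<psi> \<circ> F \<circ> inv_into W \<theta>) (at (\<theta> p)) = frechet_derivative (?G \<circ> ?\<tau>) (at (\<theta> p))"
    by (rule frechet_derivative_cong_open[OF N]) (auto simp: chart_inv[OF A] chart_inv[OF A(1) W(1)])
  also have "\<dots> = frechet_derivative ?G (at (\<phi> p)) \<circ> frechet_derivative ?\<tau> (at (\<theta> p))"
    using frechet_derivative_compose[OF \<tau>, of ?G] diff \<tau>p by simp
  finally have eq: "frechet_derivative (\<psi> \<circ> F \<circ> inv_into W \<theta>) (at (\<theta> p)) = \<dots>" .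
  have G: "bounded_linear (frechet_derivative ?G (at (\<phi> p)))"
    by (rule has_derivative_bounded_linear[OF frechet_derivative_works[THEN iffD1, OF diff]])
  have \<tau>': "bounded_linear (frechet_derivative ?\<tau> (at (\<theta> p)))"
    by (rule has_derivative_bounded_linear[OF frechet_derivative_works[THEN iffD1, OF \<tau>]])
  have "tangent_map A B F p = Blinfun (frechet_derivative ?G (at (\<phi> p)) \<circ> frechet_derivative ?\<tau> (at (\<theta> p)))"
    unfolding tangent_map_def ch B by (simp add: eq)
  also have "\<dots> = Blinfun (frechet_derivative ?G (at (\<phi> p))) o\<^sub>L Blinfun (frechet_derivative ?\<tau> (at (\<theta> p)))"
  proof (rule blinfun_eqI)
    fix v
    have "bounded_linear (frechet_derivative ?G (at (\<phi> p)) \<circ> frechet_derivative ?\<tau> (at (\<theta> p)))"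
      using bounded_linear_compose[OF G \<tau>'] by (simp add: comp_def)
    then show "Blinfun (frechet_derivative ?G (at (\<phi> p)) \<circ> frechet_derivative ?\<tau> (at (\<theta> p))) v =
      (Blinfun (frechet_derivative ?G (at (\<phi> p))) o\<^sub>L Blinfun (frechet_derivative ?\<tau> (at (\<theta> p)))) v"
      by (simp only: bounded_linear_Blinfun_apply blinfun_apply_blinfun_compose G \<tau>' o_apply)
  qed
  also have "Blinfun (frechet_derivative ?\<tau> (at (\<theta> p))) = tangent_map A flat_atlas \<phi> p"
    unfolding tangent_map_def ch by simp
  finally show ?thesis .
qed

text \<open>The transposed map \<open>\<alpha> \<mapsto> \<alpha> o\<^sub>L L\<close> is linear and acts on each slot separately.\<close>
lemma pushforward_multivector:
  assumes "T \<in> multivectors n"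
  shows "pushforward L T \<in> multivectors n"
proof -
  have T: "skew_multilinear n T" "\<And>\<alpha>s. length \<alpha>s \<noteq> n \<Longrightarrow> T \<alpha>s = 0"
    using assms by (auto simp: multivectors_def)
  have lin: "linear (\<lambda>\<alpha>. \<alpha> o\<^sub>L L)"
    by (rule linearI) (auto simp: blinfun.add_left blinfun.scaleR_left intro!: blinfun_eqI)
  have "linear (\<lambda>\<alpha>. T (map (\<lambda>\<alpha>. \<alpha> o\<^sub>L L) (\<alpha>s[i := \<alpha>])))" if "length \<alpha>s = n" "i < n" for \<alpha>s i
  proof -
    have "linear (\<lambda>\<beta>. T ((map (\<lambda>\<alpha>. \<alpha> o\<^sub>L L) \<alpha>s)[i := \<beta>]))"
      using T(1) that by (simp add: skew_multilinear_def)
    from linear_compose[OF lin this] show ?thesis by (simp add: map_update comp_def)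
  qed
  moreover have "T (map (\<lambda>\<alpha>. \<alpha> o\<^sub>L L) (\<alpha>s[i := \<alpha>s ! j, j := \<alpha>s ! i])) = - T (map (\<lambda>\<alpha>. \<alpha> o\<^sub>L L) \<alpha>s)"
    if "length \<alpha>s = n" "i < n" "j < n" "i \<noteq> j" for \<alpha>s i j
  proof -
    let ?\<beta>s = "map (\<lambda>\<alpha>. \<alpha> o\<^sub>L L) \<alpha>s"
    have "T (?\<beta>s[i := ?\<beta>s ! j, j := ?\<beta>s ! i]) = - T ?\<beta>s"
      by (rule T(1)[unfolded skew_multilinear_def, THEN conjunct2, rule_format]) (use that in simp)
    then show ?thesis using that by (simp add: map_update)
  qed
  ultimately show ?thesis
    using T(2) by (simp add: pushforward_def multivectors_def skew_multilinear_def)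
qed

definition chart_rep ::
  "('p, 'e::real_normed_vector) chart set \<Rightarrow> 'p set \<Rightarrow> ('p \<Rightarrow> 'e) \<Rightarrow> ('p \<Rightarrow> 'e tensor) \<Rightarrow> 'e \<Rightarrow> 'e tensor" where
  "chart_rep A U \<phi> \<Lambda> y =
     pushforward (tangent_map A flat_atlas \<phi> (inv_into U \<phi> y)) (\<Lambda> (inv_into U \<phi> y))"

text \<open>The coordinate changes of covectors and multivectors cancel.\<close>
lemma tensor_bracket_in_chart:
  fixes A :: "('p::{t2_space, second_countable_topology}, 'e::real_inner) chart set"
  assumes A: "smooth_manifold A" "(U, \<phi>) \<in> A" and p: "p \<in> U"
    and diff: "\<And>F. F \<in> set Fs \<Longrightarrow> (F \<circ> inv_into U \<phi>) differentiable (at (\<phi> p))"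
  shows "tensor_bracket A \<Lambda> Fs p =
    chart_rep A U \<phi> \<Lambda> (\<phi> p) (map (\<lambda>F. gradient (\<phi> p) (F \<circ> inv_into U \<phi>)) Fs)"
proof -
  have "differential A F p = gradient (\<phi> p) (F \<circ> inv_into U \<phi>) o\<^sub>L tangent_map A flat_atlas \<phi> p"
    if "F \<in> set Fs" for F
    using tangent_map_in_chart[OF A p chart_at_flat, of F] diff[OF that] by (simp add: gradient_def comp_def)
  then have maps: "map (\<lambda>F. differential A F p) Fs =
     map (\<lambda>\<alpha>. \<alpha> o\<^sub>L tangent_map A flat_atlas \<phi> p) (map (\<lambda>F. gradient (\<phi> p) (F \<circ> inv_into U \<phi>)) Fs)"
    by simp
  then show ?thesis
    unfolding tensor_bracket_def chart_rep_def pushforward_def chart_inv[OF A p] by (simp only: maps)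
qed

definition extend_by_zero :: "'p set \<Rightarrow> ('p \<Rightarrow> 'e) \<Rightarrow> ('e \<Rightarrow> real) \<Rightarrow> 'p \<Rightarrow> real" where
  "extend_by_zero U \<phi> f p = (if p \<in> U then f (\<phi> p) else 0)"

text \<open>The manifold is covered by \<open>U\<close> and by the complement of the part of \<open>U\<close> that
  corresponds to \<open>C\<close>; the latter is open since compact sets in a Hausdorff space are closed.\<close>
lemma extend_by_zero_smooth:
  fixes A :: "('p::{t2_space, second_countable_topology}, 'e::real_inner) chart set" and B :: "'e set"
  assumes B: "parseval_frame B" and A: "smooth_manifold A" "(U, \<phi>) \<in> A"
    and C: "compact C" "C \<subseteq> \<phi> ` U" and f: "smooth_on UNIV f" and f0: "\<And>y. y \<notin> C \<Longrightarrow> f y = 0"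
  shows "extend_by_zero U \<phi> f \<in> smooth_functions A"
proof -
  let ?F = "extend_by_zero U \<phi> f"
  note ch = smooth_manifold_chart[OF A]
  define K where "K = inv_into U \<phi> ` C"
  have "compact K" unfolding K_def
    by (intro compact_continuous_image[OF _ C(1)] continuous_on_subset[OF homeomorphism_cont2[OF ch(3)] C(2)])
  then have K: "open (- K)" by (simp add: compact_imp_closed open_Compl)
  have KU: "K \<subseteq> U" using C(2) chart_inv[OF A] by (auto simp: K_def)
  have F0: "?F p = 0" if "p \<in> - K" for p
  proof (cases "p \<in> U")
    case True
    then have "\<phi> p \<notin> C" using that chart_inv[OF A True] by (force simp: K_def)
    then show ?thesis using True f0 by (simp add: extend_by_zero_def)
  qed (simp add: extend_by_zero_def)
  have cover: "UNIV = U \<union> - K" using KU by auto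
  have "continuous_on UNIV f" using f unfolding smooth_on_def by (metis Ck_on.simps(1))
  then have "continuous_on U (\<lambda>p. f (\<phi> p))"
    using continuous_on_compose2[OF _ homeomorphism_cont1[OF ch(3)]] by blast
  then have "continuous_on U ?F"
    by (rule continuous_on_eq) (simp add: extend_by_zero_def)
  moreover have "continuous_on (- K) ?F"
    by (rule continuous_on_eq[OF continuous_on_const]) (simp add: F0)
  ultimately have cont: "continuous_on UNIV ?F"
    unfolding cover using ch(1) K by (intro continuous_on_open_Un)
  have smooth: "smooth_on (\<psi> ` V) (?F \<circ> inv_into V \<psi>)" if V: "(V, \<psi>) \<in> A" for V \<psi>
    unfolding smooth_on_def
  proof
    fix k
    have O: "open (\<psi> ` (V \<inter> U))" "open (\<psi> ` (V \<inter> - K))"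
      using open_chart_image[OF A(1) V] ch(1) K by auto
    have "Ck_on k (\<psi> ` (V \<inter> U)) (f \<circ> (\<phi> \<circ> inv_into V \<psi>))"
      by (rule Ck_on_comp[OF B O(1) open_UNIV])
         (use transition_smooth[OF A(1) V A(2)] f in \<open>auto simp: smooth_on_def\<close>)
    then have 1: "Ck_on k (\<psi> ` (V \<inter> U)) (?F \<circ> inv_into V \<psi>)"
      by (rule Ck_on_cong[OF O(1), THEN iffD1, rotated])
         (auto simp: chart_inv[OF A(1) V] extend_by_zero_def)
    have 2: "Ck_on k (\<psi> ` (V \<inter> - K)) (?F \<circ> inv_into V \<psi>)"
      by (rule Ck_on_cong[OF O(2), THEN iffD1, OF _ Ck_on_const[OF O(2), of k 0]])
         (auto simp: chart_inv[OF A(1) V] F0)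
    have "\<psi> ` V = \<psi> ` (V \<inter> U) \<union> \<psi> ` (V \<inter> - K)" using cover by blast
    then show "Ck_on k (\<psi> ` V) (?F \<circ> inv_into V \<psi>)"
      using Ck_on_Un[OF O 1 2] by simp
  qed
  show ?thesis
    unfolding smooth_functions_def smooth_map_def flat_atlas_def using cont smooth by auto
qed

text \<open>The identity on the manifold speaks about globally defined functions only.  A smooth function
  of the coordinates becomes one after multiplication by a cutoff \<open>\<eta>\<close> that equals \<open>1\<close> near \<open>y\<close>, and this does
  not affect iterated brackets at \<open>y\<close>, because these depend only on germs.\<close>
lemma chart_rep_filippov_at:
  fixes A :: "('p::{t2_space, second_countable_topology}, 'e::real_inner) chart set" and B :: "'e set"
  assumes B: "parseval_frame B" and A: "smooth_manifold A" "(U, \<phi>) \<in> A"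
    and np: "nambu_poisson A n \<Lambda>" and y: "y \<in> \<phi> ` U" and n: "n \<ge> 1"
  shows "filippov_at n (chart_rep A U \<phi> \<Lambda>) y"
  unfolding filippov_at_def
proof (intro allI impI)
  fix fs gs :: "('e \<Rightarrow> real) list"
  assume a: "length fs = n - 1 \<and> length gs = n \<and> (\<forall>f\<in>set fs \<union> set gs. smooth_on UNIV f)"
  let ?T = "chart_rep A U \<phi> \<Lambda>" and ?inv = "inv_into U \<phi>"
  note ch = smooth_manifold_chart[OF A]
  have mv: "\<And>p. \<Lambda> p \<in> multivectors n"
    and sm: "\<And>\<alpha>s. length \<alpha>s = n \<Longrightarrow> smooth_on (\<phi> ` U) (\<lambda>y. ?T y \<alpha>s)"
    using np A(2) by (auto simp: nambu_poisson_def multivector_field_def chart_rep_def comp_def)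
  have mvT: "?T y \<in> multivectors n" for y
    unfolding chart_rep_def by (intro pushforward_multivector mv)
  obtain r where r: "r > 0" "cball y r \<subseteq> \<phi> ` U" using ch(2) y open_contains_cball by metis
  have "\<exists>\<eta> :: 'e \<Rightarrow> real. smooth_on UNIV \<eta> \<and> (\<forall>z\<in>ball y (r / 2). \<eta> z = 1) \<and> (\<forall>z. z \<notin> cball y r \<longrightarrow> \<eta> z = 0)"
  proof (rule smooth_cutoff_exists[OF r(1), of y])
    fix \<eta> :: "'e \<Rightarrow> real"
    assume "smooth_on UNIV \<eta>" "\<And>z. z \<in> ball y (r / 2) \<Longrightarrow> \<eta> z = 1" "\<And>z. z \<notin> cball y r \<Longrightarrow> \<eta> z = 0"
    then show ?thesis by (intro exI[of _ \<eta>]) simp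
  qed
  then obtain \<eta> :: "'e \<Rightarrow> real" where \<eta>: "smooth_on UNIV \<eta>" "\<And>z. z \<in> ball y (r / 2) \<Longrightarrow> \<eta> z = 1"
    "\<And>z. z \<notin> cball y r \<Longrightarrow> \<eta> z = 0" by blast
  define E where "E = (\<lambda>f. extend_by_zero U \<phi> (\<lambda>z. \<eta> z * f z))"
  define N where "N = ball y (r / 2)"
  have N: "open N" "N \<subseteq> \<phi> ` U" "y \<in> N" using r by (auto simp: N_def)
  have E_smooth: "E f \<in> smooth_functions A" if "smooth_on UNIV f" for f
    unfolding E_def
  proof (rule extend_by_zero_smooth[OF B A parseval_frame_compact_cball[OF B] r(2)])
    show "smooth_on UNIV (\<lambda>z. \<eta> z * f z)" using \<eta>(1) that by (auto simp: smooth_on_def intro: Ck_on_mult)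
  qed (simp add: \<eta>(3))
  \<comment> \<open>\<open>rep F f\<close>: near \<open>y\<close>, \<open>f\<close> is the coordinate expression of \<open>F\<close>.  Brackets respect this relation,
    which is then used for the inner and for the outer bracket.\<close>
  define rep where "rep = (\<lambda>(F :: 'p \<Rightarrow> real) f. \<forall>z\<in>N. F (?inv z) = f z \<and> f differentiable (at z))"
  have inv: "?inv z \<in> U" "\<phi> (?inv z) = z" if "z \<in> N" for z
    using that N(2) chart_inv[OF A] by auto
  have rep_E: "rep (E f) f" if "smooth_on UNIV f" for f
    using inv \<eta>(2) smooth_on_differentiable[OF that]
    by (auto simp: rep_def E_def extend_by_zero_def N_def)
  have bracket: "tensor_bracket A \<Lambda> Fs (?inv z) = tensor_bracket flat_atlas ?T hs z"
    if "list_all2 rep Fs hs" "z \<in> N" for Fs hs z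
  proof -
    have eq: "(F \<circ> ?inv) differentiable (at z)" "gradient z (F \<circ> ?inv) = gradient z f" if "rep F f" for F f
    proof -
      have F: "(F \<circ> ?inv) w = f w" if "w \<in> N" for w using \<open>rep F f\<close> that by (simp add: rep_def)
      show "(F \<circ> ?inv) differentiable (at z)"
        using differentiable_cong_open[where f = "F \<circ> ?inv" and g = f, OF N(1) \<open>z \<in> N\<close> F] \<open>rep F f\<close> \<open>z \<in> N\<close>
        unfolding rep_def by blast
      show "gradient z (F \<circ> ?inv) = gradient z f"
        using frechet_derivative_cong_open[where f = "F \<circ> ?inv" and g = f, OF N(1) \<open>z \<in> N\<close> F]
        by (simp only: gradient_def)
    qed
    have "(F \<circ> ?inv) differentiable (at z)" if "F \<in> set Fs" for F
      using list_all2_nthD[OF \<open>list_all2 rep Fs hs\<close>] that by (metis eq(1) in_set_conv_nth)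
    moreover have "map (\<lambda>F. gradient z (F \<circ> ?inv)) Fs = map (gradient z) hs"
      using \<open>list_all2 rep Fs hs\<close> eq(2) by (intro nth_equalityI) (auto simp: list_all2_conv_all_nth)
    ultimately show ?thesis
      using tensor_bracket_in_chart[OF A inv(1)[OF \<open>z \<in> N\<close>], of Fs \<Lambda>] inv(2)[OF \<open>z \<in> N\<close>]
      by (simp add: tensor_bracket_flat)
  qed
  have rep_bracket: "rep (tensor_bracket A \<Lambda> (map E hs)) (tensor_bracket flat_atlas ?T hs)"
    if "length hs = n" "\<And>h. h \<in> set hs \<Longrightarrow> smooth_on UNIV h" for hs
  proof -
    have "tensor_bracket flat_atlas ?T hs differentiable (at z)" if "z \<in> N" for z
    proof -
      have "((\<lambda>y. ?T y \<alpha>s) has_derivative frechet_derivative (\<lambda>y. ?T y \<alpha>s) (at z)) (at z)"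
        if "length \<alpha>s = n" for \<alpha>s
        using smooth_on_differentiable[OF sm[OF that]] \<open>z \<in> N\<close> N(2)
        by (intro frechet_derivative_works[THEN iffD1]) auto
      from tensor_bracket_flat_has_derivative[where T = ?T, OF B mvT \<open>length hs = n\<close> \<open>\<And>h. h \<in> set hs \<Longrightarrow> smooth_on UNIV h\<close> this]
      show ?thesis by (auto simp: differentiable_def)
    qed
    moreover have "list_all2 rep (map E hs) hs"
      using that(2) rep_E by (simp add: list_all2_conv_all_nth)
    ultimately show ?thesis using bracket[of "map E hs" hs] by (simp add: rep_def)
  qed
  have E_rep: "list_all2 rep (map E fs) fs" "list_all2 rep (map E gs) gs"
    using a rep_E by (auto simp: list_all2_conv_all_nth)
  have fil: "tensor_bracket A \<Lambda> (map E fs @ [tensor_bracket A \<Lambda> (map E gs)]) =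
     (\<Sum>i<n. tensor_bracket A \<Lambda> ((map E gs)[i := tensor_bracket A \<Lambda> (map E fs @ [map E gs ! i])]))"
    by (rule np[unfolded nambu_poisson_def filippov_identity_def, THEN conjunct2, rule_format])
       (use a E_smooth in auto)
  have "tensor_bracket flat_atlas ?T (fs @ [tensor_bracket flat_atlas ?T gs]) y =
     tensor_bracket A \<Lambda> (map E fs @ [tensor_bracket A \<Lambda> (map E gs)]) (?inv y)"
    using a by (intro bracket[symmetric] list_all2_appendI E_rep N(3)) (auto intro: rep_bracket)
  also have "\<dots> = (\<Sum>i<n. tensor_bracket A \<Lambda> ((map E gs)[i := tensor_bracket A \<Lambda> (map E fs @ [map E gs ! i])]) (?inv y))"
    by (simp only: fil sum_pointwise)
  also have "\<dots> = (\<Sum>i<n. tensor_bracket flat_atlas ?T (gs[i := tensor_bracket flat_atlas ?T (fs @ [gs ! i])]) y)"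
  proof (intro sum.cong[OF refl] bracket list_all2_update_cong E_rep N(3))
    fix i assume "i \<in> {..<n}"
    then have "rep (tensor_bracket A \<Lambda> (map E (fs @ [gs ! i]))) (tensor_bracket flat_atlas ?T (fs @ [gs ! i]))"
      using a n by (intro rep_bracket) auto
    then show "rep (tensor_bracket A \<Lambda> (map E fs @ [map E gs ! i])) (tensor_bracket flat_atlas ?T (fs @ [gs ! i]))"
      using a \<open>i \<in> {..<n}\<close> by simp
  qed
  finally show "tensor_bracket flat_atlas ?T (fs @ [tensor_bracket flat_atlas ?T gs]) y =
     (\<Sum>i<n. tensor_bracket flat_atlas ?T (gs[i := tensor_bracket flat_atlas ?T (fs @ [gs ! i])]) y)" .
qed

section \<open>The cocycle of a multiplicative tensor\<close>

text \<open>Near a zero \<open>x\<close> of \<open>u\<close> the values \<open>u(y)\<close> are of the order of \<open>|y - x|\<close>, so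
  replacing \<open>a(y)\<close> by \<open>a(x)\<close> changes the product by less than that order.\<close>
lemma has_derivative_mult_continuous:
  fixes a u :: "'a::real_normed_vector \<Rightarrow> real"
  assumes a: "isCont a x" and u: "(u has_derivative u') (at x)" and u0: "u x = 0"
  shows "((\<lambda>y. a y * u y) has_derivative (\<lambda>v. a x * u' v)) (at x)"
  unfolding has_derivative_at_within
proof (intro conjI)
  have bl: "bounded_linear u'" using u by (rule has_derivative_bounded_linear)
  then show "bounded_linear (\<lambda>v. a x * u' v)" by (rule bounded_linear_const_mult)
  obtain K where K: "\<And>v. norm (u' v) \<le> norm v * K" "K > 0" using bounded_linear.pos_bounded[OF bl] by blast
  have a_lim: "(a \<longlongrightarrow> a x) (at x)" using a by (simp add: isCont_def)
  have "((\<lambda>y. (u y - u' (y - x)) /\<^sub>R norm (y - x)) \<longlongrightarrow> 0) (at x)"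
    using u by (simp add: has_derivative_at_within u0)
  from tendsto_mult[OF a_lim this]
  have 1: "((\<lambda>y. a y * ((u y - u' (y - x)) /\<^sub>R norm (y - x))) \<longlongrightarrow> 0) (at x)" by simp
  have 2: "((\<lambda>y. (a y - a x) * (u' (y - x) /\<^sub>R norm (y - x))) \<longlongrightarrow> 0) (at x)"
  proof (rule Lim_null_comparison)
    have "((\<lambda>y. \<bar>a y - a x\<bar> * K) \<longlongrightarrow> \<bar>a x - a x\<bar> * K) (at x)"
      by (intro tendsto_intros a_lim)
    then show "((\<lambda>y. \<bar>a y - a x\<bar> * K) \<longlongrightarrow> 0) (at x)" by simp
    have "norm ((a y - a x) * (u' (y - x) /\<^sub>R norm (y - x))) \<le> \<bar>a y - a x\<bar> * K" for y
    proof -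
      have "norm (u' (y - x) /\<^sub>R norm (y - x)) \<le> K"
        using K(1)[of "y - x"] K(2) by (cases "y = x") (auto simp: field_simps)
      then show ?thesis unfolding norm_mult real_norm_def[of "a y - a x"] by (intro mult_left_mono) auto
    qed
    then show "\<forall>\<^sub>F y in at x. norm ((a y - a x) * (u' (y - x) /\<^sub>R norm (y - x))) \<le> \<bar>a y - a x\<bar> * K"
      by simp
  qed
  have eq: "a y * ((u y - u' (y - x)) /\<^sub>R norm (y - x)) + (a y - a x) * (u' (y - x) /\<^sub>R norm (y - x)) =
     (a y * u y - a x * u x - a x * u' (y - x)) /\<^sub>R norm (y - x)" for y
    by (simp add: u0 algebra_simps)
  from tendsto_add[OF 1 2]
  show "((\<lambda>y. (a y * u y - a x * u x - a x * u' (y - x)) /\<^sub>R norm (y - x)) \<longlongrightarrow> 0) (at x)"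
    unfolding eq by simp
qed

locale multiplicative_tensor =
  fixes A :: "('g::{t2_space, second_countable_topology}, 'e::real_inner) chart set"
    and mul :: "'g \<Rightarrow> 'g \<Rightarrow> 'g" and e :: 'g and iv :: "'g \<Rightarrow> 'g"
    and n :: nat and \<Lambda> :: "'g \<Rightarrow> 'e tensor" and U :: "'g set" and \<phi> :: "'g \<Rightarrow> 'e" and B :: "'e set"
  assumes lie_group: "lie_group A mul e iv"
    and field: "multivector_field A n \<Lambda>"
    and multiplicative: "multiplicative A mul \<Lambda>"
    and chart_e: "chart_at A e = (U, \<phi>)"
    and frame: "parseval_frame B"
begin

lemma manifold: "smooth_manifold A" and group: "group mul e iv"
  and smooth_mul: "smooth_map (prod_atlas A A) A (\<lambda>(g, h). mul g h)"
  and smooth_iv: "smooth_map A A iv"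
  using lie_group by (auto simp: lie_group_def)

lemma chart: "(U, \<phi>) \<in> A" and e_in: "e \<in> U"
  using chart_at_chart[OF manifold chart_e] by auto

lemmas chart_props = smooth_manifold_chart[OF manifold chart]
lemmas inv_chart = chart_inv[OF manifold chart]

lemma group_laws: "mul e g = g" "mul g e = g" "mul g (iv g) = e" "iv e = e"
proof -
  interpret group mul e iv by (rule group)
  show "mul e g = g" "mul g e = g" "mul g (iv g) = e" "iv e = e" by simp_all
qed

abbreviation (input) \<psi> where "\<psi> \<equiv> inv_into U \<phi>"
abbreviation (input) x0 where "x0 \<equiv> \<phi> e"
abbreviation (input) T where "T \<equiv> chart_rep A U \<phi> \<Lambda>"

lemma x0_in: "x0 \<in> \<phi> ` U" and \<psi>_x0: "\<psi> x0 = e"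
  using e_in inv_chart by auto

text \<open>Multiplicativity at \<open>e \<cdot> e = e\<close> reads \<open>\<Lambda>(e) = \<Lambda>(e) + \<Lambda>(e)\<close>.\<close>
lemma vanishes_at_unit: "\<Lambda> e \<alpha>s = 0"
proof -
  have "frechet_derivative (\<phi> \<circ> (\<lambda>x. x) \<circ> \<psi>) (at x0) = frechet_derivative (\<lambda>y. y) (at x0)"
    by (rule frechet_derivative_cong_open[OF chart_props(2) x0_in]) (auto simp: inv_chart)
  then have id: "tangent_map A A (\<lambda>x. x) e = id_blinfun"
    unfolding tangent_map_def by (simp add: chart_e id_blinfun_def id_blinfun.abs_eq)
  have "pushforward id_blinfun (\<Lambda> e) = \<Lambda> e"
  proof -
    have "\<alpha> o\<^sub>L id_blinfun = \<alpha>" for \<alpha> :: "'e \<Rightarrow>\<^sub>L real" by (rule blinfun_eqI) simp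
    then show ?thesis by (simp add: pushforward_def)
  qed
  moreover have "\<Lambda> (mul e e) = pushforward (tangent_map A A (\<lambda>x. mul e x) e) (\<Lambda> e) +
      pushforward (tangent_map A A (\<lambda>x. mul x e) e) (\<Lambda> e)"
    using multiplicative unfolding multiplicative_def by blast
  ultimately have "\<Lambda> e = \<Lambda> e + \<Lambda> e" by (simp add: group_laws id)
  from fun_cong[OF this, of \<alpha>s] show ?thesis by simp
qed

lemma T_multivector: "T y \<in> multivectors n"
  using field unfolding multivector_field_def chart_rep_def by (intro pushforward_multivector) auto

lemma T_smooth: "length \<alpha>s = n \<Longrightarrow> smooth_on (\<phi> ` U) (\<lambda>y. T y \<alpha>s)"
  using field chart by (auto simp: multivector_field_def chart_rep_def comp_def)

lemma T_x0: "T x0 \<alpha>s = 0"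
  by (simp add: chart_rep_def pushforward_def \<psi>_x0 vanishes_at_unit)

sublocale linearization B n T "\<phi> ` U" x0 "\<lambda>X \<alpha>s. frechet_derivative (\<lambda>y. T y \<alpha>s) (at x0) X"
  using frame T_multivector chart_props(2) x0_in T_smooth T_x0
  by unfold_locales (auto simp: smooth_on_def simp del: Ck_on.simps)

definition mul_chart :: "'e \<times> 'e \<Rightarrow> 'e" where
  "mul_chart = \<phi> \<circ> (\<lambda>(g, h). mul g h) \<circ> inv_into (U \<times> U) (map_prod \<phi> \<phi>)"

definition iv_chart :: "'e \<Rightarrow> 'e" where "iv_chart y = \<phi> (iv (\<psi> y))"

text \<open>In coordinates, the tangent map at \<open>g\<close> of right translation by the inverse of \<open>g\<close>,
  written as a partial derivative of the multiplication so that its continuity in \<open>g\<close> becomes visible.\<close>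
definition right_derivative :: "'e \<Rightarrow> 'e \<Rightarrow> 'e" where
  "right_derivative y v = frechet_derivative mul_chart (at (y, iv_chart y)) (v, 0)"

lemma mul_chart_eq: "g \<in> U \<Longrightarrow> h \<in> U \<Longrightarrow> mul_chart (\<phi> g, \<phi> h) = \<phi> (mul g h)"
proof -
  assume gh: "g \<in> U" "h \<in> U"
  have "inj_on \<phi> U" using inv_chart by (metis inj_onI)
  then have "inv_into (U \<times> U) (map_prod \<phi> \<phi>) (map_prod \<phi> \<phi> (g, h)) = (g, h)"
    using gh by (intro inv_into_f_f map_prod_inj_on) auto
  then show ?thesis by (simp add: mul_chart_def)
qed

definition mul_dom :: "('e \<times> 'e) set" where
  "mul_dom = map_prod \<phi> \<phi> ` ((U \<times> U) \<inter> (\<lambda>(g, h). mul g h) -` U)"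

lemma mul_chart_smooth: "smooth_on mul_dom mul_chart"
proof -
  have "(U \<times> U, map_prod \<phi> \<phi>) \<in> prod_atlas A A" using chart by (auto simp: prod_atlas_def)
  then show ?thesis
    using smooth_mul chart unfolding smooth_map_def mul_dom_def mul_chart_def by fast
qed

lemma diagonal_in_dom:
  assumes "g \<in> U" "iv g \<in> U"
  shows "(\<phi> g, iv_chart (\<phi> g)) \<in> mul_dom"
proof -
  have "(\<phi> g, iv_chart (\<phi> g)) = map_prod \<phi> \<phi> (g, iv g)" by (simp add: iv_chart_def inv_chart assms)
  moreover have "(g, iv g) \<in> (U \<times> U) \<inter> (\<lambda>(g, h). mul g h) -` U" using assms e_in by (simp add: group_laws)
  ultimately show ?thesis unfolding mul_dom_def by (metis imageI)
qed

lemma right_translation_derivative: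
  assumes g: "g \<in> U" "iv g \<in> U"
  shows "((\<phi> \<circ> (\<lambda>x. mul x (iv g)) \<circ> \<psi>) has_derivative right_derivative (\<phi> g)) (at (\<phi> g))"
proof -
  have "mul_chart differentiable (at (\<phi> g, iv_chart (\<phi> g)))"
    by (rule smooth_on_differentiable[OF mul_chart_smooth diagonal_in_dom[OF g]])
  then have "(mul_chart has_derivative frechet_derivative mul_chart (at (\<phi> g, iv_chart (\<phi> g))))
     (at (\<phi> g, iv_chart (\<phi> g)))" by (rule frechet_derivative_works[THEN iffD1])
  moreover have "((\<lambda>y. (y, iv_chart (\<phi> g))) has_derivative (\<lambda>v. (v, 0))) (at (\<phi> g))"
    by (auto intro!: derivative_eq_intros)
  ultimately have "((\<lambda>y. mul_chart (y, iv_chart (\<phi> g))) has_derivative right_derivative (\<phi> g)) (at (\<phi> g))"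
    unfolding right_derivative_def using has_derivative_compose by fast
  then show ?thesis
  proof (rule has_derivative_transform_within_open[OF _ chart_props(2)])
    show "\<phi> g \<in> \<phi> ` U" using g by simp
    fix y assume "y \<in> \<phi> ` U"
    then obtain h where "h \<in> U" "y = \<phi> h" by blast
    then show "mul_chart (y, iv_chart (\<phi> g)) = (\<phi> \<circ> (\<lambda>x. mul x (iv g)) \<circ> \<psi>) y"
      by (simp add: iv_chart_def inv_chart g mul_chart_eq)
  qed
qed

lemma right_derivative_unit: "right_derivative x0 v = v"
proof -
  have "((\<phi> \<circ> (\<lambda>x. mul x (iv e)) \<circ> \<psi>) has_derivative (\<lambda>v. v)) (at x0)"
    by (rule has_derivative_transform_within_open[OF has_derivative_ident chart_props(2) x0_in])
       (auto simp: group_laws inv_chart)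
  from has_derivative_unique[OF this right_translation_derivative[of e]]
  show ?thesis using e_in by (simp add: group_laws fun_eq_iff)
qed

text \<open>Where \<open>g\<close> and its inverse both lie in the chart at the unit.\<close>
definition small_nbhd :: "'e set" where "small_nbhd = \<phi> ` (U \<inter> iv -` U)"

lemma small_nbhd: "open small_nbhd" "x0 \<in> small_nbhd"
proof -
  have "continuous_on UNIV iv" using smooth_iv by (simp add: smooth_map_def)
  then have "open (iv -` U)" using chart_props(1) by (simp add: open_vimage)
  then show "open small_nbhd" unfolding small_nbhd_def by (rule open_chart_image[OF manifold chart])
  show "x0 \<in> small_nbhd" using e_in by (simp add: small_nbhd_def group_laws)
qed

lemma right_derivative_continuous: "isCont (\<lambda>y. right_derivative y v) x0"
proof -
  have "Ck_on 1 mul_dom mul_chart" using mul_chart_smooth unfolding smooth_on_def by blast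
  then have c: "continuous_on mul_dom (\<lambda>z. frechet_derivative mul_chart (at z) (v, 0))" by simp
  have "continuous_on small_nbhd iv_chart"
  proof -
    have "continuous_on UNIV iv" using smooth_iv by (simp add: smooth_map_def)
    moreover have "continuous_on small_nbhd \<psi>"
      using homeomorphism_cont2[OF chart_props(3)] by (rule continuous_on_subset) (auto simp: small_nbhd_def)
    ultimately have 1: "continuous_on small_nbhd (\<lambda>y. iv (\<psi> y))"
      using continuous_on_compose2 by blast
    have "(\<lambda>y. iv (\<psi> y)) ` small_nbhd \<subseteq> U" by (auto simp: small_nbhd_def inv_chart)
    from continuous_on_compose2[OF homeomorphism_cont1[OF chart_props(3)] 1 this]
    show ?thesis by (simp add: iv_chart_def[abs_def])
  qed
  then have "continuous_on small_nbhd (\<lambda>y. (y, iv_chart y))" by (intro continuous_intros)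
  moreover have "(\<lambda>y. (y, iv_chart y)) ` small_nbhd \<subseteq> mul_dom"
    using diagonal_in_dom by (auto simp: small_nbhd_def)
  ultimately have "continuous_on small_nbhd (\<lambda>y. right_derivative y v)"
    unfolding right_derivative_def by (rule continuous_on_compose2[OF c])
  then show ?thesis using small_nbhd by (simp add: continuous_on_eq_continuous_at)
qed

text \<open>The right trivialization arises from \<open>\<Lambda>\<close> by applying the tangent map of right
  translation to every slot, here expanded in components.\<close>
lemma right_trivialization_in_chart:
  assumes y: "y \<in> small_nbhd" and len: "length \<alpha>s = n"
  shows "right_trivialization A mul iv \<Lambda> (\<psi> y) \<alpha>s =
    (\<Sum>bs\<in>frame_lists n B. (\<Prod>k<n. (\<alpha>s ! k) (right_derivative y (bs ! k))) * T y (map blinfun_inner_right bs))"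
proof -
  obtain g where g: "g \<in> U" "iv g \<in> U" "y = \<phi> g" using y by (auto simp: small_nbhd_def)
  have \<psi>y: "\<psi> y = g" using g inv_chart by simp
  note D = right_translation_derivative[OF g(1,2)]
  have chart_ge: "chart_at A (mul g (iv g)) = (U, \<phi>)" by (simp add: group_laws chart_e)
  let ?R = "Blinfun (right_derivative y)"
  have "tangent_map A A (\<lambda>x. mul x (iv g)) g = ?R o\<^sub>L tangent_map A flat_atlas \<phi> g"
    using tangent_map_in_chart[where F = "\<lambda>x. mul x (iv g)" and B = A, OF manifold chart g(1) chart_ge] D
    by (auto simp: differentiable_def frechet_derivative_at[OF D, symmetric] g(3))
  moreover have "(\<alpha> o\<^sub>L L) o\<^sub>L L' = \<alpha> o\<^sub>L (L o\<^sub>L L')"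
    for \<alpha> :: "'e \<Rightarrow>\<^sub>L real" and L L' :: "'e \<Rightarrow>\<^sub>L 'e" by (rule blinfun_eqI) simp
  ultimately have "right_trivialization A mul iv \<Lambda> g \<alpha>s = T y (map (\<lambda>\<alpha>. \<alpha> o\<^sub>L ?R) \<alpha>s)"
    unfolding right_trivialization_def chart_rep_def pushforward_def \<psi>y
    by (simp add: comp_def)
  also have "\<dots> = (\<Sum>bs\<in>frame_lists n B. (\<Prod>k<n. (\<alpha>s ! k) (right_derivative y (bs ! k))) *
      T y (map blinfun_inner_right bs))"
  proof -
    have "blinfun_apply ?R = right_derivative y"
      using has_derivative_bounded_linear[OF D] g(3) by (simp add: bounded_linear_Blinfun_apply)
    then show ?thesis
      using multivector_expand[OF frame T_multivector, of "map (\<lambda>\<alpha>. \<alpha> o\<^sub>L ?R) \<alpha>s" y] len by simp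
  qed
  finally show ?thesis by (simp only: \<psi>y)
qed

text \<open>In the component expansion of the right trivialization, the components of \<open>\<Lambda>\<close> vanish
  at the unit.  Hence only the derivatives of the components contribute to the derivative of the sum, with the values of the coefficients at the unit, where right translation is the identity.\<close>
lemma cocycle_eq_linearization:
  "cocycle A mul e iv \<Lambda> X \<alpha>s = frechet_derivative (\<lambda>y. T y \<alpha>s) (at x0) X"
proof -
  let ?\<delta> = "\<lambda>X \<alpha>s. frechet_derivative (\<lambda>y. T y \<alpha>s) (at x0) X"
  let ?r = "\<lambda>y. right_trivialization A mul iv \<Lambda> (\<psi> y) \<alpha>s"
  have coc: "cocycle A mul e iv \<Lambda> X \<alpha>s = Blinfun (frechet_derivative ?r (at x0)) X"
    unfolding cocycle_def intrinsic_derivative_def tangent_map_def chart_e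
    by (simp add: comp_def)
  have "(?r has_derivative (\<lambda>X. ?\<delta> X \<alpha>s)) (at x0)"
  proof (cases "length \<alpha>s = n")
    case True
    let ?s = "\<lambda>y. \<Sum>bs\<in>frame_lists n B. (\<Prod>k<n. (\<alpha>s ! k) (right_derivative y (bs ! k))) *
        T y (map blinfun_inner_right bs)"
    have "(?s has_derivative (\<lambda>X. \<Sum>bs\<in>frame_lists n B.
        (\<Prod>k<n. (\<alpha>s ! k) (right_derivative x0 (bs ! k))) * ?\<delta> X (map blinfun_inner_right bs))) (at x0)"
    proof (intro has_derivative_sum has_derivative_mult_continuous \<delta>_has_derivative T_x0)
      fix bs :: "'e list"
      show "isCont (\<lambda>y. \<Prod>k<n. (\<alpha>s ! k) (right_derivative y (bs ! k))) x0"
        by (intro continuous_prod bounded_linear.isCont[OF blinfun.bounded_linear_right] right_derivative_continuous)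
    qed
    also have "(\<lambda>X. \<Sum>bs\<in>frame_lists n B. (\<Prod>k<n. (\<alpha>s ! k) (right_derivative x0 (bs ! k))) *
        ?\<delta> X (map blinfun_inner_right bs)) = (\<lambda>X. ?\<delta> X \<alpha>s)"
      unfolding right_derivative_unit using multivector_expand[OF frame \<delta>_multivector True] by simp
    finally have "(?s has_derivative (\<lambda>X. ?\<delta> X \<alpha>s)) (at x0)" .
    then show ?thesis
      by (rule has_derivative_transform_within_open[OF _ small_nbhd]) (simp add: right_trivialization_in_chart True)
  next
    case False
    have "\<Lambda> g \<beta>s = 0" if "length \<beta>s \<noteq> n" for g \<beta>s
      using field that by (simp add: multivector_field_def multivectors_def)
    then show ?thesis using False zero_outside[OF False]
      by (simp add: right_trivialization_def pushforward_def)
  qed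
  note r = this
  have "bounded_linear (\<lambda>X. ?\<delta> X \<alpha>s)" using r by (rule has_derivative_bounded_linear)
  then show ?thesis unfolding coc frechet_derivative_at[OF r, symmetric]
    by (simp add: bounded_linear_Blinfun_apply)
qed

end

section \<open>Linear Nambu-Poisson tensors\<close>

lemma nambu_poisson_linearI:
  fixes \<delta> :: "'e::real_inner \<Rightarrow> 'e tensor" and B :: "'e set"
  assumes B: "parseval_frame B" and lin: "linear_multivector_field \<delta>"
    and mv: "\<And>X. \<delta> X \<in> multivectors n" and fil: "\<And>X. filippov_at n \<delta> X"
  shows "nambu_poisson flat_atlas n \<delta>"
proof -
  have "smooth_on UNIV (\<lambda>X. \<delta> X \<alpha>s)" for \<alpha>s
    using parseval_frame_bounded_linear[OF B] lin
    by (auto simp: smooth_on_def linear_multivector_field_def intro: Ck_on_bounded_linear)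
  moreover have "pushforward (tangent_map flat_atlas flat_atlas id X) (\<delta> X) = \<delta> X" for X
  proof -
    have "blinfun_apply (Blinfun id) = (id :: 'e \<Rightarrow> 'e)"
      by (rule bounded_linear_Blinfun_apply) (simp add: id_def bounded_linear_ident)
    then have "\<alpha> o\<^sub>L Blinfun id = \<alpha>" for \<alpha> :: "'e \<Rightarrow>\<^sub>L real" by (intro blinfun_eqI) simp
    then show ?thesis by (simp add: pushforward_def tangent_map_flat)
  qed
  ultimately have "multivector_field flat_atlas n \<delta>"
    using mv by (simp add: multivector_field_def flat_atlas_def comp_def)
  moreover have "filippov_identity n (smooth_functions flat_atlas) (tensor_bracket flat_atlas \<delta>)"
    unfolding filippov_identity_def
  proof (intro allI impI ext)
    fix fs gs :: "('e \<Rightarrow> real) list" and X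
    assume "length fs = n - 1 \<and> length gs = n \<and> set fs \<subseteq> smooth_functions flat_atlas \<and>
      set gs \<subseteq> smooth_functions flat_atlas"
    then show "tensor_bracket flat_atlas \<delta> (fs @ [tensor_bracket flat_atlas \<delta> gs]) X =
       (\<Sum>i<n. tensor_bracket flat_atlas \<delta> (gs[i := tensor_bracket flat_atlas \<delta> (fs @ [gs ! i])])) X"
      unfolding sum_pointwise
      by (intro fil[unfolded filippov_at_def, rule_format]) (auto simp: smooth_functions_flat subset_iff)
  qed
  ultimately show ?thesis by (simp add: nambu_poisson_def)
qed

text \<open>Covectors are linear functions with constant gradient, and the bracket of linear functions with
  respect to a linear tensor field is again linear.  So the identity for functions contains the one for
  \<open>\<delta>\<^sup>*\<close>.\<close>
lemma filippov_bracket_dual: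
  fixes \<delta> :: "'e::real_inner \<Rightarrow> 'e tensor" and B :: "'e set"
  assumes B: "parseval_frame B" and lin: "linear_multivector_field \<delta>"
    and mv: "\<And>X. \<delta> X \<in> multivectors n" and fil: "\<And>X. filippov_at n \<delta> X"
  shows "filippov_bracket n (dual_bracket \<delta>)"
proof -
  have apply_dual: "dual_bracket \<delta> \<alpha>s X = \<delta> X \<alpha>s" for \<alpha>s X
  proof -
    have "bounded_linear (\<lambda>X. \<delta> X \<alpha>s)"
      by (rule parseval_frame_bounded_linear[OF B]) (use lin in \<open>simp add: linear_multivector_field_def\<close>)
    from bounded_linear_Blinfun_apply[OF this] show ?thesis by (simp add: dual_bracket_def)
  qed
  have slot: "linear (\<lambda>\<beta>. \<delta> X (\<alpha>s[i := \<beta>]))" if "length \<alpha>s = n" "i < n" for X \<alpha>s i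
    using skew_multilinear_slot_linear[OF mv that] .
  have swap: "\<delta> X (\<alpha>s[i := \<alpha>s ! j, j := \<alpha>s ! i]) = - \<delta> X \<alpha>s"
    if "length \<alpha>s = n" "i < n" "j < n" "i \<noteq> j" for X \<alpha>s i j
    using mv[of X] that by (simp add: multivectors_def skew_multilinear_def)
  have "skew_multilinear n (dual_bracket \<delta>)"
    unfolding skew_multilinear_def
    by (auto intro!: linearI blinfun_eqI simp: apply_dual linear_add[OF slot] linear_scale[OF slot] swap
        blinfun.add_left blinfun.scaleR_left blinfun.minus_left)
  moreover have "filippov_identity n UNIV (dual_bracket \<delta>)"
    unfolding filippov_identity_def
  proof (intro allI impI blinfun_eqI)
    fix \<alpha>s \<beta>s :: "('e \<Rightarrow>\<^sub>L real) list" and X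
    assume a: "length \<alpha>s = n - 1 \<and> length \<beta>s = n \<and> set \<alpha>s \<subseteq> UNIV \<and> set \<beta>s \<subseteq> UNIV"
    let ?f = "blinfun_apply :: ('e \<Rightarrow>\<^sub>L real) \<Rightarrow> 'e \<Rightarrow> real"
    let ?br = "tensor_bracket flat_atlas \<delta>"
    have grad: "gradient Y (?f \<alpha>) = \<alpha>" for \<alpha> Y
    proof -
      have "(?f \<alpha> has_derivative ?f \<alpha>) (at Y)"
        by (intro bounded_linear_imp_has_derivative blinfun.bounded_linear_right)
      from frechet_derivative_at[OF this] show ?thesis
        by (simp add: gradient_def blinfun_apply_inverse)
    qed
    have br: "?br (map ?f \<gamma>s) = ?f (dual_bracket \<delta> \<gamma>s)" for \<gamma>s
      by (rule ext) (simp add: tensor_bracket_flat apply_dual comp_def grad)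
    have sm: "smooth_on UNIV (?f \<alpha>)" for \<alpha>
      unfolding smooth_on_def by (intro allI Ck_on_bounded_linear blinfun.bounded_linear_right open_UNIV)
    have "?br (map ?f \<alpha>s @ [?br (map ?f \<beta>s)]) X =
        (\<Sum>i<n. ?br ((map ?f \<beta>s)[i := ?br (map ?f \<alpha>s @ [map ?f \<beta>s ! i])]) X)"
      by (rule fil[unfolded filippov_at_def, rule_format]) (use a sm in auto)
    also have "?br (map ?f \<alpha>s @ [?br (map ?f \<beta>s)]) = ?f (dual_bracket \<delta> (\<alpha>s @ [dual_bracket \<delta> \<beta>s]))"
    proof -
      have "map ?f \<alpha>s @ [?br (map ?f \<beta>s)] = map ?f (\<alpha>s @ [dual_bracket \<delta> \<beta>s])" by (simp add: br)
      then show ?thesis by (simp only: br)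
    qed
    also have "(\<Sum>i<n. ?br ((map ?f \<beta>s)[i := ?br (map ?f \<alpha>s @ [map ?f \<beta>s ! i])]) X) =
        (\<Sum>i<n. dual_bracket \<delta> (\<beta>s[i := dual_bracket \<delta> (\<alpha>s @ [\<beta>s ! i])]) X)"
    proof (rule sum.cong[OF refl])
      fix i assume "i \<in> {..<n}"
      then have "map ?f \<alpha>s @ [map ?f \<beta>s ! i] = map ?f (\<alpha>s @ [\<beta>s ! i])" using a by simp
      then show "?br ((map ?f \<beta>s)[i := ?br (map ?f \<alpha>s @ [map ?f \<beta>s ! i])]) X =
         dual_bracket \<delta> (\<beta>s[i := dual_bracket \<delta> (\<alpha>s @ [\<beta>s ! i])]) X"
        by (simp only: br map_update[symmetric])
    qed
    finally show "dual_bracket \<delta> (\<alpha>s @ [dual_bracket \<delta> \<beta>s]) X =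
       (\<Sum>i<n. dual_bracket \<delta> (\<beta>s[i := dual_bracket \<delta> (\<alpha>s @ [\<beta>s ! i])])) X"
      by (simp only: blinfun.sum_left)
  qed
  ultimately show ?thesis by (simp add: filippov_bracket_def)
qed

theorem theorem4:
  fixes A :: "('g::{t2_space, second_countable_topology}, 'e::real_inner) chart set"
    and mul :: "'g \<Rightarrow> 'g \<Rightarrow> 'g" and e :: 'g and iv :: "'g \<Rightarrow> 'g"
    and n :: nat and \<Lambda> :: "'g \<Rightarrow> 'e tensor"
  assumes "lie_group A mul e iv"
    and "n \<ge> 1"
    and "nambu_poisson A n \<Lambda>"
    and "multiplicative A mul \<Lambda>"
  defines "\<delta> \<equiv> cocycle A mul e iv \<Lambda>"
  shows "linear_multivector_field \<delta>
    \<and> nambu_poisson flat_atlas n \<delta>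
    \<and> filippov_bracket n (dual_bracket \<delta>)"
proof -
  have A: "smooth_manifold A" using assms(1) by (simp add: lie_group_def)
  then obtain S :: "'e set" where "finite S" "span S = UNIV" by (auto simp: smooth_manifold_def)
  then obtain B :: "'e set" where B: "parseval_frame B" by (rule parseval_frame_exists)
  obtain U \<phi> where ch: "chart_at A e = (U, \<phi>)" by (cases "chart_at A e")
  interpret multiplicative_tensor A mul e iv n \<Lambda> U \<phi> B
    using assms(1,3,4) B ch by unfold_locales (auto simp: nambu_poisson_def)
  have \<delta>: "\<delta> = (\<lambda>X \<alpha>s. frechet_derivative (\<lambda>y. chart_rep A U \<phi> \<Lambda> y \<alpha>s) (at (\<phi> e)) X)"
    unfolding assms(5) using cocycle_eq_linearization by blast
  have lin: "linear_multivector_field \<delta>"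
    unfolding \<delta> linear_multivector_field_def using \<delta>_linear by blast
  have mv: "\<delta> X \<in> multivectors n" for X unfolding \<delta> by (rule \<delta>_multivector)
  have fil: "filippov_at n \<delta> X" for X
    unfolding \<delta>
    by (rule filippov_at_linearization[OF assms(2)])
       (rule chart_rep_filippov_at[OF B A chart assms(3) _ assms(2)])
  show ?thesis
    using lin nambu_poisson_linearI[OF B lin mv fil] filippov_bracket_dual[OF B lin mv fil] by blast
qed

end
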